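(* Let $\{\beta^t\}_{t\ge0}$ be the sequence generated by the method NWB or SNWB (as defined in the context) from an initial point $\beta^0\in V$, where $V:=\ker(H_\rho)^\perp$. Then $\|g^t\|\to0$ as $t\to\infty$ and $\beta^t\to\beta^\star$, where $\beta^\star$ is the unique minimizer of $\mathcal{L}$ over the restricted subspace $V$.
   Context: Let $n,m,K\ge 1$ be integers, $[K]=\{1,\dots,K\}$, $\eta,\tau>0$, and let $\Delta_d=\{x\in\mathbb{R}_+^d:\sum_i x_i=1\}$. Let $\mu_k\in\Delta_m$ ($k\in[K]$) have strictly positive entries, $C_k\in\mathbb{R}_+^{n\times m}$, $w_k>0$ with $\sum_{k=1}^K w_k=1$, and $\pi\in\Delta_n$ with strictly positive entries. For $\beta=(\beta_1^\top,\dots,\beta_K^\top)^\top\in\mathbb{R}^{mK}$ with $\beta_k\in\mathbb{R}^m$ define: - $[\alpha_k(\beta_k)]_i=-\eta\log\big(\sum_{j=1}^m[\mu_k]_j\exp(([\beta_k]_j-[C_k]_{ij})/\eta)\big)$ for $i\in[n]$, and $\Phi(\beta)=\sum_{k=1}^K w_k\alpha_k(\beta_k)\in\mathbb{R}^n$; - $\mathcal{L}(\beta)=-\sum_{k=1}^K w_k\langle\beta_k,\mu_k\rangle+\tau\log\big(\sum_{i=1}^n\pi_i\exp(-[\Phi(\beta)]_i/\tau)\big)$; - $v=v(\beta)\in\Delta_n$, $v_i=\pi_i\exp(-[\Phi(\beta)]_i/\tau)\big/\sum_{l=1}^n\pi_l\exp(-[\Phi(\beta)]_l/\tau)$; - $P_k=P_k(\beta_k)\in\mathbb{R}^{n\times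 m}$, $[P_k]_{ij}=\dfrac{[\mu_k]_j\exp(([\beta_k]_j-[C_k]_{ij})/\eta)}{\sum_{l=1}^m[\mu_k]_l\exp(([\beta_k]_l-[C_k]_{il})/\eta)}$ (row-stochastic). The gradient $g=\nabla\mathcal{L}(\beta)$ has blocks $g_k=w_k(P_k^\top v-\mu_k)$. Sparsification with threshold $\rho\ge 0$: fix $i^\star\in\arg\max_{i\in[n]}v_i$. Put $[P_{k,\rho}]_{i^\star j}=[P_k]_{i^\star j}$ for all $j$ and, for $i\neq i^\star$, $$[P_{k,\rho}]_{ij}=\frac{[P_k]_{ij}\,\mathbf{1}\{[P_k]_{ij}\ge\rho\}}{\sum_{l=1}^m[P_k]_{il}\,\mathbf{1}\{[P_k]_{il}\ge\rho\}}.$$ It is assumed, whenever $P_{k,\rho}$ is used, that these denominators are nonzero, so $P_{k,\rho}$ is row-stochastic. Let $\gamma_{k,\rho}=P_{k,\rho}^\top v$. The sparsified Hessian $H_\rho=H_\rho(\beta)$ has $m\times m$ blocks $$[H_\rho]_{kr}=\tfrac{w_kw_r}{\tau}\big(P_{k,\rho}^\top\mathrm{diag}(v)P_{r,\rho}-\gamma_{k,\rho}\gamma_{r,\rho}^\top\big)+\mathbf{1}\{k=r\}\,\tfrac{w_k}{\eta}\big(\mathrm{diag}(\gamma_{k,\rho})-P_{k,\rho}^\top\mathrm{diag}(v)P_{k,\rho}\big),$$ and $H_0=\nabla^2\mathcal{L}(\beta)$. The kernel of $H_\rho(\beta)$ does not depend on $\beta$ or $\rho$: it is the space of vectors whose blocks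 are constant, so $V=\ker(H_\rho)^\perp=\{\beta\in\mathbb{R}^{mK}:\sum_{j=1}^m[\beta_k]_j=0\ \forall k\in[K]\}$. Methods. Fix $C_\rho\ge0$: $C_\rho=0$ for NWB (the exact Newton method), $C_\rho>0$ for SNWB (the sparse Newton method). Fix $\sigma,c\in(0,1)$. At iteration $t$, let $g^t=\nabla\mathcal{L}(\beta^t)$, $\rho^t=C_\rho\|g^t\|$, $H_\rho^t=H_{\rho^t}(\beta^t)$; let $\Delta\beta^t=-(H_\rho^t+\|g^t\|I)^{-1}g^t$ (exact solution; $\Delta\beta^t=0$ if $g^t=0$); let $s^t$ be the first element of $1,c,c^2,\dots$ satisfying the Armijo condition $\mathcal{L}(\beta^t+s\Delta\beta^t)\le\mathcal{L}(\beta^t)+\sigma s\,(g^t)^\top\Delta\beta^t$; set $\beta^{t+1}=\beta^t+s^t\Delta\beta^t$. Here $\|\cdot\|$ is the Euclidean norm. *)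

theory Defs
  imports "HOL-Analysis.Analysis"
begin

definition prob_simplex :: "(real ^ 'd) set" where
  "prob_simplex = {x. (\<forall>i. 0 \<le> x $ i) \<and> (\<Sum>i\<in>UNIV. x $ i) = 1}"

definition diag_mat :: "real ^ 'd \<Rightarrow> real ^ 'd ^ 'd" where
  "diag_mat x = (\<chi> i j. if i = j then x $ i else 0)"

text \<open>
  Data of a semi-dual entropic Wasserstein barycenter problem. The finite types 'n, 'm and 'k are the
  index sets [n], [m] and [K]. A vector of dimension mK is indexed by pairs (k, j),
  where k is the block and j the position inside the block.
\<close>

record ('n, 'm, 'k) barycenter_data =
  eta :: real
  tau :: real
  marginal :: "'k \<Rightarrow> real ^ ('m::finite)"
  cost :: "'k \<Rightarrow> real ^ 'm ^ ('n::finite)"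
  weight :: "'k \<Rightarrow> real"
  prior :: "real ^ 'n"

definition barycenter_problem :: "('n::finite, 'm::finite, 'k::finite) barycenter_data \<Rightarrow> bool" where
  "barycenter_problem p \<longleftrightarrow>
     0 < eta p \<and> 0 < tau p \<and>
     (\<forall>k. marginal p k \<in> prob_simplex \<and> (\<forall>j. 0 < marginal p k $ j)) \<and>
     (\<forall>k i j. 0 \<le> cost p k $ i $ j) \<and>
     (\<forall>k. 0 < weight p k) \<and> (\<Sum>k\<in>UNIV. weight p k) = 1 \<and>
     prior p \<in> prob_simplex \<and> (\<forall>i. 0 < prior p $ i)"

definition blk :: "real ^ ('k::finite \<times> 'm::finite) \<Rightarrow> 'k \<Rightarrow> real ^ 'm" where
  "blk \<beta> k = (\<chi> j. \<beta> $ (k, j))"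

definition alpha ::
  "('n::finite, 'm::finite, 'k::finite) barycenter_data \<Rightarrow> 'k \<Rightarrow> real ^ 'm \<Rightarrow> real ^ 'n" where
  "alpha p k b = (\<chi> i. - eta p *
     ln (\<Sum>j\<in>UNIV. marginal p k $ j * exp ((b $ j - cost p k $ i $ j) / eta p)))"

definition Phi ::
  "('n::finite, 'm::finite, 'k::finite) barycenter_data \<Rightarrow> real ^ ('k \<times> 'm) \<Rightarrow> real ^ 'n" where
  "Phi p \<beta> = (\<Sum>k\<in>UNIV. weight p k *\<^sub>R alpha p k (blk \<beta> k))"

definition loss ::
  "('n::finite, 'm::finite, 'k::finite) barycenter_data \<Rightarrow> real ^ ('k \<times> 'm) \<Rightarrow> real" where
  "loss p \<beta> =
     - (\<Sum>k\<in>UNIV. weight p k * (blk \<beta> k \<bullet> marginal p k))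
     + tau p * ln (\<Sum>i\<in>UNIV. prior p $ i * exp (- (Phi p \<beta> $ i) / tau p))"

definition grad_loss ::
  "('n::finite, 'm::finite, 'k::finite) barycenter_data \<Rightarrow> real ^ ('k \<times> 'm) \<Rightarrow> real ^ ('k \<times> 'm)" where
  "grad_loss p \<beta> = (THE g. GDERIV (loss p) \<beta> :> g)"

definition bary ::
  "('n::finite, 'm::finite, 'k::finite) barycenter_data \<Rightarrow> real ^ ('k \<times> 'm) \<Rightarrow> real ^ 'n" where
  "bary p \<beta> = (\<chi> i. prior p $ i * exp (- (Phi p \<beta> $ i) / tau p) /
     (\<Sum>l\<in>UNIV. prior p $ l * exp (- (Phi p \<beta> $ l) / tau p)))"

definition plan ::
  "('n::finite, 'm::finite, 'k::finite) barycenter_data \<Rightarrow> 'k \<Rightarrow> real ^ 'm \<Rightarrow> real ^ 'm ^ 'n" where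
  "plan p k b = (\<chi> i j. marginal p k $ j * exp ((b $ j - cost p k $ i $ j) / eta p) /
     (\<Sum>l\<in>UNIV. marginal p k $ l * exp ((b $ l - cost p k $ i $ l) / eta p)))"

definition threshold :: "real \<Rightarrow> real \<Rightarrow> real" where
  "threshold \<rho> x = (if \<rho> \<le> x then x else 0)"

definition sparse_plan ::
  "('n::finite, 'm::finite, 'k::finite) barycenter_data \<Rightarrow> real \<Rightarrow> 'n \<Rightarrow> 'k \<Rightarrow> real ^ 'm \<Rightarrow> real ^ 'm ^ 'n" where
  "sparse_plan p \<rho> istar k b = (\<chi> i j.
     if i = istar then plan p k b $ i $ j
     else threshold \<rho> (plan p k b $ i $ j) / (\<Sum>l\<in>UNIV. threshold \<rho> (plan p k b $ i $ l)))"

text \<open>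
  The row istar is kept unsparsified; it must maximise the entries of bary p \<beta>, and the
  normalising denominators of all other rows must not vanish.
\<close>

definition sparsifiable ::
  "('n::finite, 'm::finite, 'k::finite) barycenter_data \<Rightarrow> real \<Rightarrow> 'n \<Rightarrow> real ^ ('k \<times> 'm) \<Rightarrow> bool" where
  "sparsifiable p \<rho> istar \<beta> \<longleftrightarrow>
     is_arg_max (\<lambda>i. bary p \<beta> $ i) (\<lambda>_. True) istar \<and>
     (\<forall>k i. i \<noteq> istar \<longrightarrow> (\<Sum>l\<in>UNIV. threshold \<rho> (plan p k (blk \<beta> k) $ i $ l)) \<noteq> 0)"

definition sparse_gamma ::
  "('n::finite, 'm::finite, 'k::finite) barycenter_data \<Rightarrow> real \<Rightarrow> 'n \<Rightarrow> real ^ ('k \<times> 'm) \<Rightarrow> 'k \<Rightarrow> real ^ 'm" where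
  "sparse_gamma p \<rho> istar \<beta> k = transpose (sparse_plan p \<rho> istar k (blk \<beta> k)) *v bary p \<beta>"

definition sparse_cross ::
  "('n::finite, 'm::finite, 'k::finite) barycenter_data \<Rightarrow> real \<Rightarrow> 'n \<Rightarrow> real ^ ('k \<times> 'm) \<Rightarrow> 'k \<Rightarrow> 'k \<Rightarrow> real ^ 'm ^ 'm" where
  "sparse_cross p \<rho> istar \<beta> k r =
     transpose (sparse_plan p \<rho> istar k (blk \<beta> k)) ** diag_mat (bary p \<beta>) ** sparse_plan p \<rho> istar r (blk \<beta> r)"

definition sparse_hessian_block ::
  "('n::finite, 'm::finite, 'k::finite) barycenter_data \<Rightarrow> real \<Rightarrow> 'n \<Rightarrow> real ^ ('k \<times> 'm) \<Rightarrow> 'k \<Rightarrow> 'k \<Rightarrow> real ^ 'm ^ 'm" where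
  "sparse_hessian_block p \<rho> istar \<beta> k r =
     (weight p k * weight p r / tau p) *\<^sub>R
       (sparse_cross p \<rho> istar \<beta> k r
        - (\<chi> i j. sparse_gamma p \<rho> istar \<beta> k $ i * sparse_gamma p \<rho> istar \<beta> r $ j))
     + (if k = r
        then (weight p k / eta p) *\<^sub>R
          (diag_mat (sparse_gamma p \<rho> istar \<beta> k) - sparse_cross p \<rho> istar \<beta> k k)
        else 0)"

definition sparse_hessian ::
  "('n::finite, 'm::finite, 'k::finite) barycenter_data \<Rightarrow> real \<Rightarrow> 'n \<Rightarrow> real ^ ('k \<times> 'm) \<Rightarrow> real ^ ('k \<times> 'm) ^ ('k \<times> 'm)" where
  "sparse_hessian p \<rho> istar \<beta> =
     (\<chi> a b. sparse_hessian_block p \<rho> istar \<beta> (fst a) (fst b) $ snd a $ snd b)"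

definition direction ::
  "('n::finite, 'm::finite, 'k::finite) barycenter_data \<Rightarrow> real \<Rightarrow> 'n \<Rightarrow> real ^ ('k \<times> 'm) \<Rightarrow> real ^ ('k \<times> 'm)" where
  "direction p C\<rho> istar \<beta> =
     (let g = grad_loss p \<beta>
      in if g = 0 then 0
         else - (matrix_inv (sparse_hessian p (C\<rho> * norm g) istar \<beta> + norm g *\<^sub>R mat 1) *v g))"

definition armijo ::
  "('n::finite, 'm::finite, 'k::finite) barycenter_data \<Rightarrow> real \<Rightarrow> real ^ ('k \<times> 'm) \<Rightarrow> real ^ ('k \<times> 'm) \<Rightarrow> real \<Rightarrow> bool" where
  "armijo p \<sigma> \<beta> d s \<longleftrightarrow>
     loss p (\<beta> + s *\<^sub>R d) \<le> loss p \<beta> + \<sigma> * s * (grad_loss p \<beta> \<bullet> d)"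

definition step_size ::
  "('n::finite, 'm::finite, 'k::finite) barycenter_data \<Rightarrow> real \<Rightarrow> real \<Rightarrow> real ^ ('k \<times> 'm) \<Rightarrow> real ^ ('k \<times> 'm) \<Rightarrow> real" where
  "step_size p \<sigma> c \<beta> d = c ^ (LEAST l. armijo p \<sigma> \<beta> d (c ^ l))"

text \<open>
  C\<rho> = 0 gives the exact Newton method, C\<rho> > 0 the sparse one. The index istar t is the
  maximising row fixed at iteration t; any choice among ties is allowed.
\<close>

definition newton_sequence ::
  "('n::finite, 'm::finite, 'k::finite) barycenter_data \<Rightarrow> real \<Rightarrow> real \<Rightarrow> real \<Rightarrow> (nat \<Rightarrow> 'n) \<Rightarrow>
   (nat \<Rightarrow> real ^ ('k \<times> 'm)) \<Rightarrow> bool" where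
  "newton_sequence p C\<rho> \<sigma> c istar \<beta> \<longleftrightarrow>
     (\<forall>t. sparsifiable p (C\<rho> * norm (grad_loss p (\<beta> t))) (istar t) (\<beta> t) \<and>
          (let d = direction p C\<rho> (istar t) (\<beta> t)
           in \<beta> (Suc t) = \<beta> t + step_size p \<sigma> c (\<beta> t) d *\<^sub>R d))"

end

theory Submission
  imports Defs
begin

text \<open>
  The loss is built from log-sum-exp functions by sums with positive weights and by composition with
  a further, increasing log-sum-exp. Jensen's inequality for the exponential, in the form
  \<open>1 + x \<le> exp x\<close>, puts each of them above its tangent (\<open>log_sum_exp_above_tangent\<close>), and the tangent
  slopes combine to the vector \<open>semidual_grad p \<beta>\<close>. So the loss lies above its tangents, strictly so
  unless the displacement is constant on every block (\<open>loss_above_tangent\<close>). A continuous field of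
  subgradients is a gradient, so this vector is \<open>grad_loss p \<beta>\<close> and no derivative of the loss is
  computed.

  The sparsified Hessian is a sum of variances: the variance of the mixture of conditional means under
  \<open>bary p \<beta>\<close>, and the conditional variances of each block under the rows of the sparsified plan
  (\<open>sparse_hessian_quadratic_form\<close>). It is therefore positive semidefinite. The unsparsified row has
  only positive entries and positive mass, so the form vanishes only on vectors that are constant on
  every block; thus \<open>V\<close> consists of the vectors whose blocks sum to zero. The entries of the Hessian
  are bounded uniformly in the threshold and the iterate.

  On \<open>V\<close> the loss dominates a positive multiple of the spread of each block, up to a constant, so its
  sublevel sets in \<open>V\<close> are bounded (\<open>bounded_loss_sublevel\<close>). The directions stay in \<open>V\<close>, have norm at
  most 1, and have a slope bounded away from 0 as long as the gradient is
  (\<open>regularized_newton_direction\<close>). On a bounded set the gradient is uniformly continuous, so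
  backtracking accepts steps bounded away from 0, and each iteration with a large gradient lowers the
  loss by a fixed amount. The loss is bounded below on the iterates, so the gradients tend to 0
  (\<open>armijo_descent_gradient_tendsto_zero\<close>). Every cluster point of the bounded sequence of iterates
  is then a critical point in \<open>V\<close>, and strict convexity along \<open>V\<close> makes that point unique and the
  minimizer.
\<close>

section \<open>Log-sum-exp and continuous subgradients\<close>

text \<open>
  With the softmax weights \<open>q\<close> and the mean \<open>m\<close> of \<open>h\<close> under \<open>q\<close>, the quotient of the two sums is
  \<open>exp m\<close> times the mean of \<open>exp (h i - m)\<close>. The latter is at least the mean of \<open>1 + (h i - m)\<close>,
  which is 1, and exceeds it if some \<open>h i\<close> differs from \<open>m\<close>.
\<close>

lemma log_sum_exp_above_tangent:
  fixes a u h :: "'a::finite \<Rightarrow> real"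
  assumes a: "\<And>i. 0 < a i"
  defines "Z \<equiv> (\<Sum>i\<in>UNIV. a i * exp (u i))"
  shows "ln Z + (\<Sum>i\<in>UNIV. a i * exp (u i) / Z * h i) \<le> ln (\<Sum>i\<in>UNIV. a i * exp (u i + h i))"
    and "h i1 \<noteq> h i2 \<Longrightarrow>
      ln Z + (\<Sum>i\<in>UNIV. a i * exp (u i) / Z * h i) < ln (\<Sum>i\<in>UNIV. a i * exp (u i + h i))"
proof -
  define q where "q i = a i * exp (u i) / Z" for i
  define m where "m = (\<Sum>i\<in>UNIV. q i * h i)"
  define W where "W = (\<Sum>i\<in>UNIV. a i * exp (u i + h i))"
  have Z: "0 < Z" unfolding Z_def by (intro sum_pos) (auto simp: a)
  have W: "0 < W" unfolding W_def by (intro sum_pos) (auto simp: a)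
  have q: "0 < q i" for i using a Z by (simp add: q_def)
  have q1: "(\<Sum>i\<in>UNIV. q i) = 1"
    using Z by (simp add: q_def Z_def flip: sum_divide_distrib)
  have eq: "W = Z * exp m * (\<Sum>i\<in>UNIV. q i * exp (h i - m))"
    using Z by (simp add: W_def sum_distrib_left q_def exp_add exp_diff field_simps)
  have one: "(\<Sum>i\<in>UNIV. q i * (1 + (h i - m))) = 1"
  proof -
    have "(\<Sum>i\<in>UNIV. q i * (1 + (h i - m))) = (\<Sum>i\<in>UNIV. q i * (1 - m) + q i * h i)"
      by (intro sum.cong) (auto simp: algebra_simps)
    also have "\<dots> = (\<Sum>i\<in>UNIV. q i) * (1 - m) + m"
      unfolding sum.distrib sum_distrib_right[symmetric] m_def[symmetric] ..
    finally show ?thesis by (simp add: q1)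
  qed
  have "(\<Sum>i\<in>UNIV. q i * (1 + (h i - m))) \<le> (\<Sum>i\<in>UNIV. q i * exp (h i - m))"
    by (intro sum_mono mult_left_mono exp_ge_add_one_self less_imp_le q)
  then have "Z * exp m \<le> W"
    unfolding eq one using Z by simp
  then have "ln (Z * exp m) \<le> ln W" using Z W by simp
  then show "ln Z + (\<Sum>i\<in>UNIV. a i * exp (u i) / Z * h i) \<le> ln (\<Sum>i\<in>UNIV. a i * exp (u i + h i))"
    using Z by (simp add: ln_mult m_def q_def W_def)
  show "ln Z + (\<Sum>i\<in>UNIV. a i * exp (u i) / Z * h i) < ln (\<Sum>i\<in>UNIV. a i * exp (u i + h i))"
    if "h i1 \<noteq> h i2"
  proof -
    have "h i1 - m \<noteq> 0 \<or> h i2 - m \<noteq> 0" using that by auto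
    then obtain i0 where i0: "h i0 - m \<noteq> 0" by blast
    have strict: "1 + x < exp x" if "x \<noteq> 0" for x :: real
    proof (cases "-1 < x")
      case True
      have "ln (1 + x) < x" 
        using ln_add_one_self_le_self2[OF True] ln_eq_minus_one[of "1 + x"] True that by fastforce
      then show ?thesis using True by (smt (verit) exp_less_mono exp_ln)
    next
      case False
      then show ?thesis by (smt (verit) exp_gt_zero)
    qed
    have "(\<Sum>i\<in>UNIV. q i * (1 + (h i - m))) < (\<Sum>i\<in>UNIV. q i * exp (h i - m))"
    proof (rule sum_strict_mono_ex1)
      show "\<forall>i\<in>UNIV. q i * (1 + (h i - m)) \<le> q i * exp (h i - m)"
        by (intro ballI mult_left_mono exp_ge_add_one_self less_imp_le q)
      show "\<exists>i\<in>UNIV. q i * (1 + (h i - m)) < q i * exp (h i - m)"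
        using strict[OF i0] q by auto
    qed simp
    then have "Z * exp m < W"
      unfolding eq one using Z by simp
    then have "ln (Z * exp m) < ln W" using Z W by simp
    then show ?thesis
      using Z by (simp add: ln_mult m_def q_def W_def)
  qed
qed

text \<open>
  Using the subgradient inequality at \<open>x\<close> and at \<open>y\<close>, the error of the linear approximation lies between
  0 and \<open>(G y - G x) \<bullet> (y - x)\<close>, which is of smaller order than \<open>y - x\<close> by continuity.
\<close>

lemma gderiv_of_continuous_subgradient:
  fixes f :: "'a::real_inner \<Rightarrow> real"
  assumes sub: "\<And>x y. f x + G x \<bullet> (y - x) \<le> f y"
    and cont: "isCont G x"
  shows "GDERIV f x :> G x"
  unfolding gderiv_def has_derivative_at_alt
proof (intro conjI allI impI)
  show "bounded_linear (\<lambda>h. h \<bullet> G x)" by (rule bounded_linear_inner_left)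
  fix e :: real assume "0 < e"
  then obtain d where d: "d > 0" "\<And>y. norm (y - x) < d \<Longrightarrow> norm (G y - G x) < e"
    using cont unfolding continuous_at_eps_delta by (auto simp: dist_norm)
  show "\<exists>d>0. \<forall>y. norm (y - x) < d \<longrightarrow> norm (f y - f x - (y - x) \<bullet> G x) \<le> e * norm (y - x)"
  proof (intro exI[of _ d] conjI allI impI)
    fix y assume y: "norm (y - x) < d"
    have "0 \<le> f y - f x - (y - x) \<bullet> G x"
      using sub[of x y] by (simp add: inner_commute)
    moreover have "f y - f x - (y - x) \<bullet> G x \<le> (G y - G x) \<bullet> (y - x)"
      using sub[of y x] by (simp add: inner_diff_left inner_diff_right inner_commute)
    moreover have "(G y - G x) \<bullet> (y - x) \<le> norm (G y - G x) * norm (y - x)"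
      by (rule norm_cauchy_schwarz)
    moreover have "norm (G y - G x) * norm (y - x) \<le> e * norm (y - x)"
      using d(2)[OF y] by (intro mult_right_mono) auto
    ultimately show "norm (f y - f x - (y - x) \<bullet> G x) \<le> e * norm (y - x)" by simp
  qed (use d in auto)
qed

lemma GDERIV_unique:
  fixes f :: "'a::real_inner \<Rightarrow> real"
  assumes "GDERIV f x :> D" "GDERIV f x :> E"
  shows "D = E"
proof -
  have "(\<lambda>h. h \<bullet> D) = (\<lambda>h. h \<bullet> E)"
    using assms has_derivative_unique unfolding gderiv_def by blast
  then show ?thesis by (metis vector_eq_ldot)
qed

section \<open>Armijo descent along gradient-related directions\<close>

text \<open>
  The subgradient inequality at the new point bounds the change of \<open>f\<close> by \<open>s * (G (x + s *\<^sub>R d) \<bullet> d)\<close>.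
  Uniform continuity of \<open>G\<close> near the bounded set keeps this slope within \<open>(1 - \<sigma>) * \<kappa>\<close> of
  \<open>G x \<bullet> d\<close>, which is exactly the slack that the Armijo condition leaves.
\<close>

lemma armijo_uniform:
  fixes f :: "'a::euclidean_space \<Rightarrow> real"
  assumes sub: "\<And>x y. f x + G x \<bullet> (y - x) \<le> f y"
    and cont: "continuous_on UNIV G"
    and "bounded K" and "0 < \<kappa>" and "\<sigma> < 1"
  obtains \<delta> where "0 < \<delta>"
    "\<And>x d s. \<lbrakk>x \<in> K; norm d \<le> 1; G x \<bullet> d \<le> - \<kappa>; 0 \<le> s; s \<le> \<delta>\<rbrakk> \<Longrightarrow>
       f (x + s *\<^sub>R d) \<le> f x + \<sigma> * s * (G x \<bullet> d)"
proof -
  obtain R where R: "\<And>x. x \<in> K \<Longrightarrow> norm x \<le> R"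
    using \<open>bounded K\<close> by (auto simp: bounded_iff)
  have "uniformly_continuous_on (cball 0 (R + 1)) G"
    by (intro compact_uniformly_continuous continuous_on_subset[OF cont]) auto
  moreover have "0 < (1 - \<sigma>) * \<kappa>" using assms by simp
  ultimately obtain \<delta> where \<delta>: "\<delta> > 0"
    "\<And>x y. \<lbrakk>x \<in> cball 0 (R + 1); y \<in> cball 0 (R + 1); dist y x < \<delta>\<rbrakk> \<Longrightarrow> dist (G y) (G x) < (1 - \<sigma>) * \<kappa>"
    unfolding uniformly_continuous_on_def by metis
  show thesis
  proof (rule that[of "min (\<delta>/2) 1"])
    show "0 < min (\<delta>/2) 1" using \<delta> by simp
    fix x d s assume x: "x \<in> K" and d: "norm d \<le> 1" and \<kappa>: "G x \<bullet> d \<le> - \<kappa>"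
      and s: "0 \<le> s" "s \<le> min (\<delta>/2) 1"
    let ?y = "x + s *\<^sub>R d"
    have sd: "norm (s *\<^sub>R d) \<le> s" using d s by (simp add: mult_left_le)
    have "norm ?y \<le> R + 1"
      using norm_triangle_ineq[of x "s *\<^sub>R d"] sd R[OF x] s by simp
    moreover have "dist ?y x < \<delta>" using sd s \<delta>(1) by (simp add: dist_norm)
    ultimately have "norm (G ?y - G x) \<le> (1 - \<sigma>) * \<kappa>"
      using \<delta>(2)[of x ?y] R[OF x] by (simp add: dist_norm[of "G _"] less_imp_le)
    then have "(G ?y - G x) \<bullet> d \<le> (1 - \<sigma>) * \<kappa>"
      using norm_cauchy_schwarz[of "G ?y - G x" d] d mult_left_le[of "norm d" "norm (G ?y - G x)"]
      by simp
    also have "\<dots> \<le> (1 - \<sigma>) * - (G x \<bullet> d)"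
      using \<kappa> \<open>\<sigma> < 1\<close> by (intro mult_left_mono) auto
    finally have "G ?y \<bullet> d \<le> \<sigma> * (G x \<bullet> d)" by (simp add: algebra_simps)
    then have "s * (G ?y \<bullet> d) \<le> s * (\<sigma> * (G x \<bullet> d))" using s by (intro mult_left_mono) auto
    then show "f ?y \<le> f x + \<sigma> * s * (G x \<bullet> d)"
      using sub[of ?y x] by (simp add: algebra_simps)
  qed
qed

lemma armijo_step_exists:
  fixes f :: "'a::euclidean_space \<Rightarrow> real"
  assumes sub: "\<And>x y. f x + G x \<bullet> (y - x) \<le> f y"
    and cont: "continuous_on UNIV G"
    and "\<sigma> < 1" and "0 < c" and "c < 1" and "norm d \<le> 1"
    and desc: "G x \<bullet> d < 0 \<or> d = 0"
  shows "\<exists>l::nat. f (x + c ^ l *\<^sub>R d) \<le> f x + \<sigma> * c ^ l * (G x \<bullet> d)"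
proof (cases "d = 0")
  case False
  then have neg: "0 < - (G x \<bullet> d)" using desc by simp
  obtain \<delta> where \<delta>: "0 < \<delta>"
    "\<And>z d' s. \<lbrakk>z \<in> {x}; norm d' \<le> 1; G z \<bullet> d' \<le> - (- (G x \<bullet> d)); 0 \<le> s; s \<le> \<delta>\<rbrakk> \<Longrightarrow>
       f (z + s *\<^sub>R d') \<le> f z + \<sigma> * s * (G z \<bullet> d')"
    using armijo_uniform[OF sub cont _ neg \<open>\<sigma> < 1\<close>, of "{x}"] by auto
  obtain l where "c ^ l < \<delta>" using real_arch_pow_inv[OF \<delta>(1) \<open>c < 1\<close>] by blast
  then show ?thesis using \<delta>(2)[of x d "c ^ l"] assms by (intro exI[of _ l]) auto
qed auto

text \<open>
  While the gradient is at least \<open>\<epsilon>\<close>, the accepted step is bounded below: either it is 1, or the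
  previous trial step was rejected and so exceeded the uniform admissible length \<open>\<delta>\<close>. Such an
  iteration lowers \<open>f\<close> by a fixed amount. Since \<open>f\<close> decreases and is bounded below on the iterates (by
  its tangent at 0), this happens only finitely often.
\<close>

lemma armijo_descent_gradient_tendsto_zero:
  fixes f :: "'a::euclidean_space \<Rightarrow> real"
  assumes sub: "\<And>x y. f x + G x \<bullet> (y - x) \<le> f y"
    and cont: "continuous_on UNIV G"
    and "0 < \<sigma>" and "\<sigma> < 1" and "0 < c" and "c < 1"
    and bdd: "bounded (range x)"
    and dir: "\<And>t. norm (d t) \<le> 1" "\<And>t. G (x t) \<bullet> d t \<le> 0"
    and related: "\<And>\<epsilon>. 0 < \<epsilon> \<Longrightarrow> \<exists>\<kappa>>0. \<forall>t. \<epsilon> \<le> norm (G (x t)) \<longrightarrow> G (x t) \<bullet> d t \<le> - \<kappa>"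
    and step: "\<And>t. x (Suc t) = x t + c ^ l t *\<^sub>R d t"
    and ok: "\<And>t. f (x t + c ^ l t *\<^sub>R d t) \<le> f (x t) + \<sigma> * c ^ l t * (G (x t) \<bullet> d t)"
    and least: "\<And>t j. j < l t \<Longrightarrow> \<not> f (x t + c ^ j *\<^sub>R d t) \<le> f (x t) + \<sigma> * c ^ j * (G (x t) \<bullet> d t)"
  shows "(\<lambda>t. norm (G (x t))) \<longlonglongrightarrow> 0"
proof -
  have dec: "f (x (Suc t)) \<le> f (x t)" for t
  proof -
    have "\<sigma> * c ^ l t * (G (x t) \<bullet> d t) \<le> 0"
      using assms dir by (intro mult_nonneg_nonpos) auto
    then show ?thesis using ok[of t] by (simp add: step)
  qed
  obtain R where R: "\<And>t. norm (x t) \<le> R" using bdd by (auto simp: bounded_iff)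
  have below: "f 0 - norm (G 0) * R \<le> f (x t)" for t
  proof -
    have "- (G 0 \<bullet> x t) \<le> norm (G 0) * norm (x t)"
      using norm_cauchy_schwarz[of "- G 0" "x t"] by simp
    also have "\<dots> \<le> norm (G 0) * R" using R by (intro mult_left_mono) auto
    finally show ?thesis using sub[of 0 "x t"] by simp
  qed
  obtain L where L: "(\<lambda>t. f (x t)) \<longlonglongrightarrow> L"
    using decseq_convergent[of "\<lambda>t. f (x t)"] below dec by (metis decseq_Suc_iff)
  have "(\<lambda>t. f (x t) - f (x (Suc t))) \<longlonglongrightarrow> L - L"
    by (intro tendsto_intros L LIMSEQ_Suc)
  then have gap: "(\<lambda>t. f (x t) - f (x (Suc t))) \<longlonglongrightarrow> 0" by simp
  show ?thesis
  proof (rule LIMSEQ_I)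
    fix \<epsilon> :: real assume "0 < \<epsilon>"
    then obtain \<kappa> where \<kappa>: "\<kappa> > 0" "\<And>t. \<epsilon> \<le> norm (G (x t)) \<Longrightarrow> G (x t) \<bullet> d t \<le> - \<kappa>"
      using related by blast
    obtain \<delta> where \<delta>: "0 < \<delta>"
      "\<And>z d s. \<lbrakk>z \<in> range x; norm d \<le> 1; G z \<bullet> d \<le> - \<kappa>; 0 \<le> s; s \<le> \<delta>\<rbrakk> \<Longrightarrow>
         f (z + s *\<^sub>R d) \<le> f z + \<sigma> * s * (G z \<bullet> d)"
      using armijo_uniform[OF sub cont bdd \<kappa>(1) \<open>\<sigma> < 1\<close>] by metis
    define s0 where "s0 = min 1 (c * \<delta>)"
    have s0: "0 < s0" using \<delta> assms by (simp add: s0_def)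
    have long: "s0 \<le> c ^ l t" if "\<epsilon> \<le> norm (G (x t))" for t
    proof (cases "l t")
      case (Suc j)
      have "\<delta> < c ^ j"
        using least[of j t] \<delta>(2)[of "x t" "d t" "c ^ j"] dir(1)[of t] \<kappa>(2)[OF that] Suc assms(5) by force
      then have "c * \<delta> < c ^ l t" using assms by (simp add: Suc)
      then show ?thesis by (simp add: s0_def)
    qed (simp add: s0_def)
    have drop: "\<sigma> * s0 * \<kappa> \<le> f (x t) - f (x (Suc t))" if "\<epsilon> \<le> norm (G (x t))" for t
    proof -
      have "\<sigma> * s0 * \<kappa> \<le> \<sigma> * c ^ l t * - (G (x t) \<bullet> d t)"
        using long[OF that] \<kappa>(2)[OF that] assms s0 \<kappa>(1)
        by (intro mult_mono) auto
      then show ?thesis using ok[of t] by (simp add: step)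
    qed
    have "0 < \<sigma> * s0 * \<kappa>" using assms s0 \<kappa> by simp
    then obtain N where "\<And>t. t \<ge> N \<Longrightarrow> norm (f (x t) - f (x (Suc t)) - 0) < \<sigma> * s0 * \<kappa>"
      using LIMSEQ_D[OF gap] by blast
    then have "\<And>t. t \<ge> N \<Longrightarrow> norm (G (x t)) < \<epsilon>"
      using drop by (smt (verit) real_norm_def)
    then show "\<exists>N. \<forall>t\<ge>N. norm (norm (G (x t)) - 0) < \<epsilon>" by auto
  qed
qed

lemma bounded_sequence_unique_cluster_point:
  fixes x :: "nat \<Rightarrow> 'a::heine_borel"
  assumes bdd: "bounded (range x)"
    and uniq: "\<And>r z. \<lbrakk>strict_mono r; (x \<circ> r) \<longlonglongrightarrow> z\<rbrakk> \<Longrightarrow> z = a"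
  shows "x \<longlonglongrightarrow> a"
proof (rule ccontr)
  assume "\<not> x \<longlonglongrightarrow> a"
  then obtain e where e: "0 < e" and "\<not> eventually (\<lambda>t. dist (x t) a < e) sequentially"
    unfolding tendsto_iff by blast
  then have "frequently (\<lambda>t. e \<le> dist (x t) a) sequentially"
    by (simp add: frequently_def not_le)
  then have "infinite {t. e \<le> dist (x t) a}"
    by (simp add: frequently_cofinite flip: cofinite_eq_sequentially)
  then obtain r :: "nat \<Rightarrow> nat" where r: "strict_mono r" "\<And>t. e \<le> dist (x (r t)) a"
    using infinite_enumerate by blast
  have "bounded (range (x \<circ> r))" using bdd by (rule bounded_subset) auto
  then obtain q z where q: "strict_mono q" "((x \<circ> r) \<circ> q) \<longlonglongrightarrow> z"
    using bounded_imp_convergent_subsequence by blast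
  then have "z = a" using uniq[of "r \<circ> q" z] r by (simp add: strict_mono_o comp_assoc)
  then have "eventually (\<lambda>t. dist (x (r (q t))) a < e) sequentially"
    using q(2) e tendstoD by (fastforce simp: comp_def)
  then obtain t where "dist (x (r (q t))) a < e"
    using eventually_happens trivial_limit_sequentially by blast
  then show False using r(2)[of "q t"] by simp
qed

section \<open>Gradient and convexity of the loss\<close>

lemma sum_pairs:
  fixes F :: "'k::finite \<times> 'm::finite \<Rightarrow> 'a::comm_monoid_add"
  shows "(\<Sum>a\<in>UNIV. F a) = (\<Sum>k\<in>UNIV. \<Sum>j\<in>UNIV. F (k, j))"
  by (simp add: sum.cartesian_product)

lemma blk_nth [simp]: "blk x k $ j = x $ (k, j)"
  by (simp add: blk_def)

lemma inner_blk: "x \<bullet> y = (\<Sum>k\<in>UNIV. blk x k \<bullet> blk y k)"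
  by (simp add: inner_vec_def sum_pairs)

lemma problemD:
  assumes "barycenter_problem p"
  shows "0 < eta p" "0 < tau p" "0 < marginal p k $ j" "(\<Sum>j\<in>UNIV. marginal p k $ j) = 1"
    "0 < weight p k" "(\<Sum>k\<in>UNIV. weight p k) = 1" "0 < prior p $ i" "(\<Sum>i\<in>UNIV. prior p $ i) = 1"
  using assms by (auto simp: barycenter_problem_def prob_simplex_def)

lemma row_normalizer_pos:
  assumes "barycenter_problem p"
  shows "0 < (\<Sum>j\<in>UNIV. marginal p k $ j * exp ((b $ j - cost p k $ i $ j) / eta p))"
  by (intro sum_pos) (auto simp: problemD[OF assms])

lemma bary_normalizer_pos:
  assumes "barycenter_problem p"
  shows "0 < (\<Sum>i\<in>UNIV. prior p $ i * exp (- (Phi p \<beta> $ i) / tau p))"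
  by (intro sum_pos) (auto simp: problemD[OF assms])

lemma plan_pos:
  assumes "barycenter_problem p"
  shows "0 < plan p k b $ i $ j"
  using row_normalizer_pos[OF assms] by (simp add: plan_def problemD[OF assms])

lemma plan_row_sum:
  assumes "barycenter_problem p"
  shows "(\<Sum>j\<in>UNIV. plan p k b $ i $ j) = 1"
  using row_normalizer_pos[OF assms, of k b i]
  by (simp add: plan_def less_imp_neq[symmetric] flip: sum_divide_distrib)

lemma bary_pos:
  assumes "barycenter_problem p"
  shows "0 < bary p \<beta> $ i"
  using bary_normalizer_pos[OF assms] by (simp add: bary_def problemD[OF assms])

lemma bary_sum:
  assumes "barycenter_problem p"
  shows "(\<Sum>i\<in>UNIV. bary p \<beta> $ i) = 1"
  using bary_normalizer_pos[OF assms, of \<beta>]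
  by (simp add: bary_def less_imp_neq[symmetric] flip: sum_divide_distrib)

text \<open>
  The closed form \<open>w\<^sub>k (P\<^sub>k\<^sup>T v - \<mu>\<^sub>k)\<close> of the gradient. It is first shown to be a subgradient, and
  identified with \<open>grad_loss\<close> afterwards.
\<close>

definition semidual_grad ::
  "('n::finite, 'm::finite, 'k::finite) barycenter_data \<Rightarrow> real ^ ('k \<times> 'm) \<Rightarrow> real ^ ('k \<times> 'm)" where
  "semidual_grad p \<beta> = (\<chi> a. weight p (fst a) *
     ((\<Sum>i\<in>UNIV. bary p \<beta> $ i * plan p (fst a) (blk \<beta> (fst a)) $ i $ snd a)
      - marginal p (fst a) $ snd a))"

lemma Phi_nth: "Phi p \<beta> $ i = (\<Sum>k\<in>UNIV. weight p k * alpha p k (blk \<beta> k) $ i)"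
  by (simp add: Phi_def)

lemma alpha_below_tangent:
  assumes p: "barycenter_problem p"
  shows "alpha p k b' $ i \<le> alpha p k b $ i - (\<Sum>j\<in>UNIV. plan p k b $ i $ j * (b' $ j - b $ j))"
    and "b' $ j1 - b $ j1 \<noteq> b' $ j2 - b $ j2 \<Longrightarrow>
      alpha p k b' $ i < alpha p k b $ i - (\<Sum>j\<in>UNIV. plan p k b $ i $ j * (b' $ j - b $ j))"
proof -
  note eta = problemD(1)[OF p] and mu = problemD(3)[OF p]
  define h where "h j = (b' $ j - b $ j) / eta p" for j
  define u where "u j = (b $ j - cost p k $ i $ j) / eta p" for j
  have uh: "u j + h j = (b' $ j - cost p k $ i $ j) / eta p" for j
    using eta by (simp add: u_def h_def field_simps)
  have tangent: "eta p * (\<Sum>j\<in>UNIV. marginal p k $ j * exp (u j) /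
        (\<Sum>j\<in>UNIV. marginal p k $ j * exp (u j)) * h j)
      = (\<Sum>j\<in>UNIV. plan p k b $ i $ j * (b' $ j - b $ j))"
    using eta unfolding sum_distrib_left
    by (intro sum.cong) (simp_all add: plan_def u_def h_def)
  have alpha_eq: "alpha p k b $ i = - (eta p * ln (\<Sum>j\<in>UNIV. marginal p k $ j * exp (u j)))"
    "alpha p k b' $ i = - (eta p * ln (\<Sum>j\<in>UNIV. marginal p k $ j * exp (u j + h j)))"
    unfolding uh by (simp_all add: alpha_def u_def)
  note lse = log_sum_exp_above_tangent[where a = "($) (marginal p k)" and u = u and h = h, OF mu]
  show "alpha p k b' $ i \<le> alpha p k b $ i - (\<Sum>j\<in>UNIV. plan p k b $ i $ j * (b' $ j - b $ j))"
    using mult_left_mono[OF lse(1) less_imp_le[OF eta]]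
    unfolding distrib_left tangent alpha_eq by linarith
  show "alpha p k b' $ i < alpha p k b $ i - (\<Sum>j\<in>UNIV. plan p k b $ i $ j * (b' $ j - b $ j))"
    if "b' $ j1 - b $ j1 \<noteq> b' $ j2 - b $ j2"
  proof -
    have "h j1 \<noteq> h j2" using that eta by (simp add: h_def)
    from mult_strict_left_mono[OF lse(2)[OF this] eta]
    show ?thesis unfolding distrib_left tangent alpha_eq by linarith
  qed
qed

text \<open>
  Convexity is chained through the two layers. The inner layer bounds the decrease of \<open>Phi\<close> below by
  the averages \<open>\<delta>\<close> of the displacement under the plans; the outer log-sum-exp has softmax weights
  \<open>bary p x\<close>, and averaging \<open>\<delta>\<close> with them and adding the linear term gives the gradient pairing.
  One block with a nonconstant displacement makes the inner inequality strict in every row.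
\<close>

lemma loss_above_tangent:
  assumes p: "barycenter_problem p"
  shows "loss p x + semidual_grad p x \<bullet> (y - x) \<le> loss p y"
    and "(y - x) $ (k0, j1) \<noteq> (y - x) $ (k0, j2) \<Longrightarrow>
      loss p x + semidual_grad p x \<bullet> (y - x) < loss p y"
proof -
  note tau = problemD(2)[OF p] and w = problemD(5)[OF p]
  define \<delta> where "\<delta> i = (\<Sum>k\<in>UNIV. weight p k *
    (\<Sum>j\<in>UNIV. plan p k (blk x k) $ i $ j * (y - x) $ (k, j)))" for i
  have lin: "semidual_grad p x \<bullet> (y - x) = (\<Sum>i\<in>UNIV. bary p x $ i * \<delta> i)
      - (\<Sum>k\<in>UNIV. weight p k * (blk y k \<bullet> marginal p k))
      + (\<Sum>k\<in>UNIV. weight p k * (blk x k \<bullet> marginal p k))"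
  proof -
    have "(\<Sum>i\<in>UNIV. bary p x $ i * \<delta> i) = (\<Sum>i\<in>UNIV. \<Sum>k\<in>UNIV. \<Sum>j\<in>UNIV.
       weight p k * (bary p x $ i * plan p k (blk x k) $ i $ j) * (y - x) $ (k, j))"
      by (simp add: \<delta>_def sum_distrib_left mult_ac)
    also have "\<dots> = (\<Sum>k\<in>UNIV. \<Sum>j\<in>UNIV. \<Sum>i\<in>UNIV.
       weight p k * (bary p x $ i * plan p k (blk x k) $ i $ j) * (y - x) $ (k, j))"
      by (subst sum.swap, intro sum.cong refl, rule sum.swap)
    also have "\<dots> = (\<Sum>k\<in>UNIV. \<Sum>j\<in>UNIV.
       weight p k * (\<Sum>i\<in>UNIV. bary p x $ i * plan p k (blk x k) $ i $ j) * (y - x) $ (k, j))"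
      by (simp only: sum_distrib_left sum_distrib_right)
    finally have "(\<Sum>i\<in>UNIV. bary p x $ i * \<delta> i) = \<dots>" .
    moreover have "(\<Sum>k\<in>UNIV. weight p k * (blk y k \<bullet> marginal p k))
        - (\<Sum>k\<in>UNIV. weight p k * (blk x k \<bullet> marginal p k))
      = (\<Sum>k\<in>UNIV. \<Sum>j\<in>UNIV. weight p k * marginal p k $ j * (y - x) $ (k, j))"
      by (simp add: inner_vec_def sum_distrib_left algebra_simps flip: sum_subtractf)
    ultimately show ?thesis
      by (simp add: inner_vec_def sum_pairs semidual_grad_def sum_subtractf algebra_simps)
        (simp add: sum.distrib sum_subtractf algebra_simps)
  qed
  define h where "h i = (Phi p x $ i - Phi p y $ i) / tau p" for i
  define u where "u i = - (Phi p x $ i) / tau p" for i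
  have uh: "u i + h i = - (Phi p y $ i) / tau p" for i
    using tau by (simp add: u_def h_def field_simps)
  have tangent: "tau p * (\<Sum>i\<in>UNIV. prior p $ i * exp (u i) /
        (\<Sum>i\<in>UNIV. prior p $ i * exp (u i)) * h i)
      = (\<Sum>i\<in>UNIV. bary p x $ i * (Phi p x $ i - Phi p y $ i))"
    using tau unfolding sum_distrib_left
    by (intro sum.cong) (simp_all add: bary_def u_def h_def)
  note lse = log_sum_exp_above_tangent(1)[where a = "($) (prior p)" and u = u and h = h, OF problemD(7)[OF p]]
  have outer: "tau p * ln (\<Sum>i\<in>UNIV. prior p $ i * exp (- (Phi p x $ i) / tau p))
      + (\<Sum>i\<in>UNIV. bary p x $ i * (Phi p x $ i - Phi p y $ i))
      \<le> tau p * ln (\<Sum>i\<in>UNIV. prior p $ i * exp (- (Phi p y $ i) / tau p))"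
    using mult_left_mono[OF lse less_imp_le[OF tau]]
    unfolding distrib_left tangent uh unfolding u_def .
  have diff: "Phi p x $ i - Phi p y $ i = (\<Sum>k\<in>UNIV. weight p k *
      (alpha p k (blk x k) $ i - alpha p k (blk y k) $ i))" for i
    by (simp add: Phi_nth sum_subtractf algebra_simps)
  have le: "(\<Sum>j\<in>UNIV. plan p k (blk x k) $ i $ j * (y - x) $ (k, j))
      \<le> alpha p k (blk x k) $ i - alpha p k (blk y k) $ i" for i k
    using alpha_below_tangent(1)[OF p, of k "blk y k" i "blk x k"] by simp
  have "\<delta> i \<le> Phi p x $ i - Phi p y $ i" for i
    unfolding \<delta>_def diff by (intro sum_mono mult_left_mono le less_imp_le[OF w])
  then have "(\<Sum>i\<in>UNIV. bary p x $ i * \<delta> i)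
      \<le> (\<Sum>i\<in>UNIV. bary p x $ i * (Phi p x $ i - Phi p y $ i))"
    by (intro sum_mono mult_left_mono less_imp_le[OF bary_pos[OF p]])
  then show "loss p x + semidual_grad p x \<bullet> (y - x) \<le> loss p y"
    using outer unfolding lin loss_def by linarith
  show "loss p x + semidual_grad p x \<bullet> (y - x) < loss p y"
    if ne: "(y - x) $ (k0, j1) \<noteq> (y - x) $ (k0, j2)"
  proof -
    have lt: "(\<Sum>j\<in>UNIV. plan p k0 (blk x k0) $ i $ j * (y - x) $ (k0, j))
      < alpha p k0 (blk x k0) $ i - alpha p k0 (blk y k0) $ i" for i
      using alpha_below_tangent(2)[OF p, of "blk y k0" j1 "blk x k0" j2 k0 i] ne by simp
    have "\<delta> i < Phi p x $ i - Phi p y $ i" for i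
      unfolding \<delta>_def diff
    proof (rule sum_strict_mono_ex1)
      show "\<forall>k\<in>UNIV. weight p k * (\<Sum>j\<in>UNIV. plan p k (blk x k) $ i $ j * (y - x) $ (k, j))
          \<le> weight p k * (alpha p k (blk x k) $ i - alpha p k (blk y k) $ i)"
        by (intro ballI mult_left_mono le less_imp_le[OF w])
      show "\<exists>k\<in>UNIV. weight p k * (\<Sum>j\<in>UNIV. plan p k (blk x k) $ i $ j * (y - x) $ (k, j))
          < weight p k * (alpha p k (blk x k) $ i - alpha p k (blk y k) $ i)"
        using mult_strict_left_mono[OF lt w] by blast
    qed simp
    then have "(\<Sum>i\<in>UNIV. bary p x $ i * \<delta> i)
        < (\<Sum>i\<in>UNIV. bary p x $ i * (Phi p x $ i - Phi p y $ i))"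
      by (intro sum_strict_mono mult_strict_left_mono bary_pos p) auto
    then show ?thesis using outer unfolding lin loss_def by linarith
  qed
qed

lemma continuous_semidual_grad:
  fixes p :: "('n::finite, 'm::finite, 'k::finite) barycenter_data"
  assumes p: "barycenter_problem p"
  shows "continuous_on UNIV (semidual_grad p)"
proof -
  have eta: "eta p \<noteq> 0" and tau: "tau p \<noteq> 0"
    using problemD(1,2)[OF p] by auto
  have "continuous_on UNIV (\<lambda>x. exp ((x $ (k, j) - cost p k $ i $ j) / eta p))" for k i j
    by (intro continuous_intros ballI eta)
  then have kernel: "continuous_on UNIV
      (\<lambda>x. marginal p k $ j * exp ((blk x k $ j - cost p k $ i $ j) / eta p))" for k i j
    unfolding blk_nth by (intro continuous_on_mult_left)
  have row: "continuous_on UNIV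
      (\<lambda>x. \<Sum>j\<in>UNIV. marginal p k $ j * exp ((blk x k $ j - cost p k $ i $ j) / eta p))" for k i
    by (intro continuous_on_sum kernel)
  have plan: "continuous_on UNIV (\<lambda>x. plan p k (blk x k) $ i $ j)" for k i j
    unfolding plan_def vec_lambda_beta
    by (intro continuous_on_divide kernel row ballI row_normalizer_pos[OF p, THEN less_imp_neq, symmetric])
  have ln_row: "continuous_on UNIV
      (\<lambda>x. ln (\<Sum>j\<in>UNIV. marginal p k $ j * exp ((blk x k $ j - cost p k $ i $ j) / eta p)))" for k i
    by (intro continuous_on_ln row ballI row_normalizer_pos[OF p, THEN less_imp_neq, symmetric])
  have Phi: "continuous_on UNIV (\<lambda>x. Phi p x $ i)" for i
    unfolding Phi_nth alpha_def vec_lambda_beta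
    by (intro continuous_on_sum continuous_on_mult_left ln_row)
  have weight: "continuous_on UNIV (\<lambda>x. prior p $ i * exp (- (Phi p x $ i) / tau p))" for i
    by (intro continuous_intros ballI Phi tau)
  have bary: "continuous_on UNIV (\<lambda>x. bary p x $ i)" for i
    unfolding bary_def vec_lambda_beta
    by (intro continuous_on_divide continuous_on_sum weight ballI
        bary_normalizer_pos[OF p, THEN less_imp_neq, symmetric])
  show ?thesis
    unfolding semidual_grad_def
    by (intro continuous_on_vec_lambda continuous_intros plan bary)
qed

text \<open>
  The gradient is defined by a definite description, so existence comes from the continuous
  subgradient and uniqueness from the uniqueness of derivatives.
\<close>

lemma grad_loss_eq:
  assumes p: "barycenter_problem p"
  shows "grad_loss p = semidual_grad p"
proof
  fix \<beta>
  have "GDERIV (loss p) \<beta> :> semidual_grad p \<beta>"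
    using loss_above_tangent(1)[OF p] continuous_semidual_grad[OF p]
    by (intro gderiv_of_continuous_subgradient) (auto simp: continuous_on_eq_continuous_at)
  then show "grad_loss p \<beta> = semidual_grad p \<beta>"
    unfolding grad_loss_def by (metis GDERIV_unique the_equality)
qed

lemma semidual_grad_block_sum:
  assumes p: "barycenter_problem p"
  shows "(\<Sum>j\<in>UNIV. semidual_grad p \<beta> $ (k, j)) = 0"
proof -
  have "(\<Sum>j\<in>UNIV. \<Sum>i\<in>UNIV. bary p \<beta> $ i * plan p k (blk \<beta> k) $ i $ j)
      = (\<Sum>i\<in>UNIV. bary p \<beta> $ i * (\<Sum>j\<in>UNIV. plan p k (blk \<beta> k) $ i $ j))"
    by (subst sum.swap) (simp add: sum_distrib_left)
  then show ?thesis
    by (simp add: semidual_grad_def sum_subtractf plan_row_sum[OF p] bary_sum[OF p] problemD(4)[OF p]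
        flip: sum_distrib_left)
qed

section \<open>Coercivity on the block-centred subspace\<close>

definition block_centred :: "(real ^ ('k::finite \<times> 'm::finite)) set" where
  "block_centred = {x. \<forall>k. (\<Sum>j\<in>UNIV. x $ (k, j)) = 0}"

text \<open>
  Keeping a single summand of each inner sum shows that \<open>- alpha p k b\<close> dominates every entry of \<open>b\<close> up
  to a constant. The choice \<open>J\<close> of an entry in each block is left free, so that it can later pick the
  largest ones.
\<close>

lemma loss_lower_bound:
  fixes p :: "('n::finite, 'm::finite, 'k::finite) barycenter_data"
  assumes p: "barycenter_problem p"
  obtains B where "\<And>x J. (\<Sum>k\<in>UNIV. weight p k * (x $ (k, J k) - blk x k \<bullet> marginal p k)) - B \<le> loss p x"
proof -
  note eta = problemD(1)[OF p] and tau = problemD(2)[OF p] and mu = problemD(3)[OF p] and w = problemD(5)[OF p]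
  define c where "c a = (case a of (k, i, j) \<Rightarrow> cost p k $ i $ j - eta p * ln (marginal p k $ j))" for a
  define B where "B = Max (range c)"
  have B: "cost p k $ i $ j - eta p * ln (marginal p k $ j) \<le> B" for k i j
  proof -
    have "c (k, i, j) \<le> B" unfolding B_def by (intro Max_ge) auto
    then show ?thesis by (simp add: c_def)
  qed
  have alpha: "b $ j - B \<le> - alpha p k b $ i" for k b i j
  proof -
    let ?t = "\<lambda>j. marginal p k $ j * exp ((b $ j - cost p k $ i $ j) / eta p)"
    have "?t j \<le> (\<Sum>j\<in>UNIV. ?t j)"
      by (intro member_le_sum) (auto simp: less_imp_le mu)
    then have "eta p * ln (?t j) \<le> eta p * ln (\<Sum>j\<in>UNIV. ?t j)"
      using mu eta by (intro mult_left_mono) (auto simp: row_normalizer_pos[OF p])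
    moreover have "eta p * ln (?t j) = eta p * ln (marginal p k $ j) + (b $ j - cost p k $ i $ j)"
      using mu[of k j] eta by (simp add: ln_mult distrib_left)
    ultimately show ?thesis using B[of k i j] by (simp add: alpha_def)
  qed
  show thesis
  proof (rule that[of B])
    fix x :: "real ^ ('k \<times> 'm)" and J
    define Q where "Q = (\<Sum>k\<in>UNIV. weight p k * x $ (k, J k)) - B"
    have Phi: "Q \<le> - Phi p x $ i" for i
    proof -
      have "Q = (\<Sum>k\<in>UNIV. weight p k * (blk x k $ J k - B))"
        by (simp add: Q_def right_diff_distrib sum_subtractf problemD(6)[OF p] flip: sum_distrib_right)
      also have "\<dots> \<le> (\<Sum>k\<in>UNIV. weight p k * - alpha p k (blk x k) $ i)"
        using alpha[of "blk x _" "J _"] w by (intro sum_mono mult_left_mono) (auto simp: less_imp_le)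
      finally show ?thesis by (simp add: Phi_nth sum_negf)
    qed
    have "exp (Q / tau p) = (\<Sum>i\<in>UNIV. prior p $ i * exp (Q / tau p))"
      by (simp add: problemD(8)[OF p] flip: sum_distrib_right)
    also have "\<dots> \<le> (\<Sum>i\<in>UNIV. prior p $ i * exp (- (Phi p x $ i) / tau p))"
      using divide_right_mono[OF Phi less_imp_le[OF tau]]
      by (intro sum_mono mult_left_mono less_imp_le[OF problemD(7)[OF p]]) simp
    finally have "Q / tau p \<le> ln (\<Sum>i\<in>UNIV. prior p $ i * exp (- (Phi p x $ i) / tau p))"
      using bary_normalizer_pos[OF p] by (simp add: ln_ge_iff)
    then have "Q \<le> tau p * ln (\<Sum>i\<in>UNIV. prior p $ i * exp (- (Phi p x $ i) / tau p))"
      using tau by (simp add: field_simps)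
    then show "(\<Sum>k\<in>UNIV. weight p k * (x $ (k, J k) - blk x k \<bullet> marginal p k)) - B \<le> loss p x"
      by (simp add: Q_def loss_def right_diff_distrib sum_subtractf)
  qed
qed

text \<open>
  With \<open>J\<close> picking the maximal entry of each block, the lower bound is a sum of nonnegative terms
  \<open>w\<^sub>k \<mu>\<^sub>k\<^sub>j (max - x\<^sub>k\<^sub>j)\<close>, so each of them is bounded on a sublevel set, and with it the spread of
  every block. A block with zero sum has a nonnegative maximum and a nonpositive entry, so its
  entries are bounded by its spread.
\<close>

lemma bounded_loss_sublevel:
  fixes p :: "('n::finite, 'm::finite, 'k::finite) barycenter_data"
  assumes p: "barycenter_problem p"
  shows "bounded {x \<in> block_centred. loss p x \<le> c}"
proof -
  note mu = problemD(3)[OF p] and w = problemD(5)[OF p]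
  obtain B where B: "\<And>x J. (\<Sum>k\<in>UNIV. weight p k * (x $ (k, J k) - blk x k \<bullet> marginal p k)) - B \<le> loss p x"
    using loss_lower_bound[OF p] by blast
  define \<omega> where "\<omega> = Min (range (\<lambda>(k, j). weight p k * marginal p k $ j))"
  have \<omega>: "\<omega> \<le> weight p k * marginal p k $ j" for k j
    unfolding \<omega>_def by (intro Min_le) (auto intro!: image_eqI[of _ _ "(k, j)"])
  have \<omega>0: "0 < \<omega>" unfolding \<omega>_def by (subst Min_gr_iff) (auto simp: w mu)
  define R where "R = (c + B) / \<omega>"
  have comp: "\<bar>x $ a\<bar> \<le> R" if x: "x \<in> block_centred" "loss p x \<le> c" for x and a :: "'k \<times> 'm"
  proof -
    obtain k0 j0 where a: "a = (k0, j0)" by (cases a)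
    have "\<exists>j. \<forall>j'. x $ (k, j') \<le> x $ (k, j)" for k
    proof -
      have "Max (range (\<lambda>j. x $ (k, j))) \<in> range (\<lambda>j. x $ (k, j))" by (intro Max_in) auto
      then obtain j where "Max (range (\<lambda>j. x $ (k, j))) = x $ (k, j)" by (rule rangeE)
      moreover have "x $ (k, j') \<le> Max (range (\<lambda>j. x $ (k, j)))" for j' by (intro Max_ge) auto
      ultimately show ?thesis by metis
    qed
    then obtain J where J: "\<And>k j'. x $ (k, j') \<le> x $ (k, J k)" by metis
    have gap: "x $ (k, J k) - blk x k \<bullet> marginal p k
        = (\<Sum>j\<in>UNIV. marginal p k $ j * (x $ (k, J k) - x $ (k, j)))" for k
      by (simp add: right_diff_distrib sum_subtractf problemD(4)[OF p] inner_vec_def mult.commute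
          flip: sum_distrib_right sum_distrib_left)
    have spread: "x $ (k0, J k0) - x $ (k0, j) \<le> R" for j
    proof -
      have "\<omega> * (x $ (k0, J k0) - x $ (k0, j))
          \<le> weight p k0 * marginal p k0 $ j * (x $ (k0, J k0) - x $ (k0, j))"
        using J by (intro mult_right_mono \<omega>) simp
      also have "\<dots> \<le> weight p k0 * (x $ (k0, J k0) - blk x k0 \<bullet> marginal p k0)"
        unfolding gap mult.assoc using w J mu
        by (intro mult_left_mono member_le_sum[of j _ "\<lambda>j. marginal p k0 $ j * (x $ (k0, J k0) - x $ (k0, j))"])
          (auto simp: less_imp_le)
      also have "\<dots> \<le> (\<Sum>k\<in>UNIV. weight p k * (x $ (k, J k) - blk x k \<bullet> marginal p k))"
        unfolding gap using w J mu
        by (intro member_le_sum[of k0 _ "\<lambda>k. weight p k * (\<Sum>j\<in>UNIV. marginal p k $ j * (x $ (k, J k) - x $ (k, j)))"])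
          (auto intro!: mult_nonneg_nonneg sum_nonneg simp: less_imp_le)
      also have "\<dots> \<le> c + B" using B[of x J] x(2) by simp
      finally show ?thesis using \<omega>0 by (simp add: R_def field_simps)
    qed
    have zero: "(\<Sum>j\<in>UNIV. x $ (k0, j)) = 0" using x(1) by (simp add: block_centred_def)
    have "0 \<le> x $ (k0, J k0)"
    proof (rule ccontr)
      assume "\<not> 0 \<le> x $ (k0, J k0)"
      then have "\<And>j. x $ (k0, j) < 0" using J by (smt (verit))
      then have "(\<Sum>j\<in>UNIV. x $ (k0, j)) < (\<Sum>j\<in>(UNIV::'m set). 0)"
        by (intro sum_strict_mono) auto
      then show False using zero by simp
    qed
    moreover have "\<exists>j. x $ (k0, j) \<le> 0"
    proof (rule ccontr)
      assume "\<nexists>j. x $ (k0, j) \<le> 0"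
      then have "0 < (\<Sum>j\<in>UNIV. x $ (k0, j))" by (intro sum_pos) (auto simp: not_le)
      then show False using zero by simp
    qed
    ultimately show ?thesis
      using spread J[of k0 j0] unfolding a by (smt (verit))
  qed
  show ?thesis
  proof (rule boundedI)
    fix x assume "x \<in> {x \<in> block_centred. loss p x \<le> c}"
    then have "(\<Sum>a\<in>UNIV. \<bar>x $ a\<bar>) \<le> (\<Sum>a\<in>(UNIV::('k \<times> 'm) set). R)"
      using comp by (intro sum_mono) auto
    then show "norm x \<le> (\<Sum>a\<in>(UNIV::('k \<times> 'm) set). R)"
      using norm_le_l1_cart[of x] by linarith
  qed
qed

section \<open>The sparsified Hessian as a quadratic form\<close>

lemma inner_transpose_mult: "a \<bullet> (transpose M *v u) = (M *v a) \<bullet> u" for M :: "real ^ 'b ^ 'a"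
  by (metis dot_lmul_matrix inner_commute transpose_matrix_vector)

lemma diag_mat_mult: "(diag_mat v *v u) $ i = v $ i * u $ i"
  by (simp add: diag_mat_def matrix_vector_mult_def if_distrib[of "\<lambda>x. x * _"] cong: if_cong)

lemma outer_product_mult: "a \<bullet> ((\<chi> i j. g $ i * h $ j) *v z) = (a \<bullet> g) * (h \<bullet> z)"
  for a g :: "real ^ 'a" and h z :: "real ^ 'b"
proof -
  have "((\<chi> i j. g $ i * h $ j) *v z) $ i = g $ i * (h \<bullet> z)" for i
    by (simp add: matrix_vector_mult_def inner_vec_def sum_distrib_left mult.assoc)
  then show ?thesis
    by (simp add: inner_vec_def[of a] sum_distrib_right mult.assoc)
qed

lemma sparse_plan_nonneg:
  assumes p: "barycenter_problem p"
  shows "0 \<le> sparse_plan p \<rho> istar k b $ i $ j"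
  using plan_pos[OF p, of k b]
  by (auto simp: sparse_plan_def threshold_def less_imp_le intro!: divide_nonneg_nonneg sum_nonneg)

lemma sparse_plan_row_sum:
  assumes p: "barycenter_problem p" and s: "sparsifiable p \<rho> istar \<beta>"
  shows "(\<Sum>j\<in>UNIV. sparse_plan p \<rho> istar k (blk \<beta> k) $ i $ j) = 1"
proof (cases "i = istar")
  case True
  then show ?thesis by (simp add: sparse_plan_def plan_row_sum[OF p])
next
  case False
  then show ?thesis using s by (simp add: sparse_plan_def sparsifiable_def flip: sum_divide_distrib)
qed

lemma sparse_plan_istar_pos:
  assumes p: "barycenter_problem p"
  shows "0 < sparse_plan p \<rho> istar k b $ istar $ j"
  using plan_pos[OF p] by (simp add: sparse_plan_def)

text \<open>
  Row \<open>i\<close> of the sparsified plan is a probability distribution on the positions of block \<open>k\<close>; this is the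
  mean of the block \<open>blk x k\<close> under it.
\<close>

definition plan_mean ::
  "('n::finite, 'm::finite, 'k::finite) barycenter_data \<Rightarrow> real \<Rightarrow> 'n \<Rightarrow> real ^ ('k \<times> 'm) \<Rightarrow>
   'k \<Rightarrow> real ^ ('k \<times> 'm) \<Rightarrow> 'n \<Rightarrow> real" where
  "plan_mean p \<rho> istar \<beta> k x i = (sparse_plan p \<rho> istar k (blk \<beta> k) *v blk x k) $ i"

definition mixture_mean ::
  "('n::finite, 'm::finite, 'k::finite) barycenter_data \<Rightarrow> real \<Rightarrow> 'n \<Rightarrow> real ^ ('k \<times> 'm) \<Rightarrow>
   real ^ ('k \<times> 'm) \<Rightarrow> 'n \<Rightarrow> real" where
  "mixture_mean p \<rho> istar \<beta> x i = (\<Sum>k\<in>UNIV. weight p k * plan_mean p \<rho> istar \<beta> k x i)"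

text \<open>
  The bilinear form of the Hessian is the covariance of the mixture means under \<open>bary p \<beta>\<close>, plus, for
  each block, the mean of the product minus the mean of the product of the conditional means. Symmetry, semidefiniteness
  and the kernel are all read off from this identity.
\<close>

lemma inner_sparse_hessian:
  fixes p :: "('n::finite, 'm::finite, 'k::finite) barycenter_data"
  defines "v \<equiv> bary p" and "A \<equiv> plan_mean p" and "F \<equiv> mixture_mean p"
  shows "y \<bullet> (sparse_hessian p \<rho> istar \<beta> *v x) =
    ((\<Sum>i\<in>UNIV. v \<beta> $ i * (F \<rho> istar \<beta> y i * F \<rho> istar \<beta> x i))
      - (\<Sum>i\<in>UNIV. v \<beta> $ i * F \<rho> istar \<beta> y i) * (\<Sum>i\<in>UNIV. v \<beta> $ i * F \<rho> istar \<beta> x i)) / tau p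
    + (\<Sum>k\<in>UNIV. weight p k / eta p *
        ((\<Sum>j\<in>UNIV. sparse_gamma p \<rho> istar \<beta> k $ j * (y $ (k, j) * x $ (k, j)))
          - (\<Sum>i\<in>UNIV. v \<beta> $ i * (A \<rho> istar \<beta> k y i * A \<rho> istar \<beta> k x i))))"
proof -
  let ?S = "\<lambda>k. sparse_plan p \<rho> istar k (blk \<beta> k)"
  let ?\<gamma> = "sparse_gamma p \<rho> istar \<beta>"
  let ?C = "sparse_cross p \<rho> istar \<beta>"
  define V where "V i = v \<beta> $ i" for i
  define a where "a k z i = A \<rho> istar \<beta> k z i" for k z i
  define f where "f z i = F \<rho> istar \<beta> z i" for z i
  define E where "E k z = (\<Sum>i\<in>UNIV. V i * a k z i)" for k z
  define X where "X k r = (\<Sum>i\<in>UNIV. V i * (a k y i * a r x i))" for k r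
  define D where "D k = (\<Sum>j\<in>UNIV. ?\<gamma> k $ j * (y $ (k, j) * x $ (k, j)))" for k
  have f: "f z i = (\<Sum>k\<in>UNIV. weight p k * a k z i)" for z i
    by (simp add: f_def F_def mixture_mean_def a_def A_def)
  have mean: "(\<Sum>k\<in>UNIV. weight p k * E k z) = (\<Sum>i\<in>UNIV. V i * f z i)" for z
  proof -
    have "(\<Sum>k\<in>UNIV. weight p k * E k z) = (\<Sum>k\<in>UNIV. \<Sum>i\<in>UNIV. V i * (weight p k * a k z i))"
      unfolding E_def sum_distrib_left by (intro sum.cong refl) (simp add: mult_ac)
    also have "\<dots> = (\<Sum>i\<in>UNIV. V i * f z i)"
      unfolding f sum_distrib_left by (rule sum.swap)
    finally show ?thesis .
  qed
  have cross: "blk y k \<bullet> (?C k r *v blk x r) = X k r" for k r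
    unfolding sparse_cross_def matrix_vector_mul_assoc[symmetric] inner_transpose_mult
    by (simp add: inner_vec_def diag_mat_mult X_def V_def v_def a_def A_def plan_mean_def mult_ac)
  have \<gamma>: "blk z k \<bullet> ?\<gamma> k = E k z" for z k
    unfolding sparse_gamma_def inner_transpose_mult
    by (simp add: inner_vec_def E_def V_def v_def a_def A_def plan_mean_def mult_ac)
  have diag: "blk y k \<bullet> (diag_mat (?\<gamma> k) *v blk x k) = D k" for k
    by (simp add: inner_vec_def diag_mat_mult D_def mult_ac)
  have block: "blk y k \<bullet> (sparse_hessian_block p \<rho> istar \<beta> k r *v blk x r)
      = weight p k * weight p r / tau p * (X k r - E k y * E r x)
        + (if k = r then weight p k / eta p * (D k - X k k) else 0)" for k r
    by (simp add: sparse_hessian_block_def matrix_vector_mult_add_rdistrib matrix_vector_mult_diff_rdistrib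
        inner_add_right inner_diff_right cross \<gamma> diag outer_product_mult
        inner_commute[of "?\<gamma> r"] flip: scaleR_matrix_vector_assoc)
  have "blk (sparse_hessian p \<rho> istar \<beta> *v x) k
      = (\<Sum>r\<in>UNIV. sparse_hessian_block p \<rho> istar \<beta> k r *v blk x r)" for k
    by (simp add: vec_eq_iff matrix_vector_mult_def sum_pairs sparse_hessian_def)
  then have "y \<bullet> (sparse_hessian p \<rho> istar \<beta> *v x)
      = (\<Sum>k\<in>UNIV. \<Sum>r\<in>UNIV. blk y k \<bullet> (sparse_hessian_block p \<rho> istar \<beta> k r *v blk x r))"
    by (simp add: inner_blk inner_sum_right)
  also have "\<dots> = (\<Sum>k\<in>UNIV. \<Sum>r\<in>UNIV. weight p k * weight p r / tau p * (X k r - E k y * E r x))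
      + (\<Sum>k\<in>UNIV. weight p k / eta p * (D k - X k k))"
    by (simp add: block sum.distrib)
  also have "(\<Sum>k\<in>UNIV. \<Sum>r\<in>UNIV. weight p k * weight p r / tau p * (X k r - E k y * E r x))
      = ((\<Sum>k\<in>UNIV. \<Sum>r\<in>UNIV. weight p k * weight p r * X k r)
         - (\<Sum>k\<in>UNIV. weight p k * E k y) * (\<Sum>r\<in>UNIV. weight p r * E r x)) / tau p"
    unfolding sum_product sum_subtractf[symmetric] sum_divide_distrib
    by (intro sum.cong refl) (simp add: algebra_simps diff_divide_distrib)
  also have "(\<Sum>k\<in>UNIV. \<Sum>r\<in>UNIV. weight p k * weight p r * X k r)
      = (\<Sum>i\<in>UNIV. V i * (f y i * f x i))"
  proof -
    have "(\<Sum>i\<in>UNIV. V i * (f y i * f x i))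
        = (\<Sum>i\<in>UNIV. \<Sum>k\<in>UNIV. \<Sum>r\<in>UNIV. weight p k * weight p r * (V i * (a k y i * a r x i)))"
      unfolding f sum_product by (intro sum.cong refl) (simp add: sum_distrib_left mult_ac)
    also have "\<dots> = (\<Sum>k\<in>UNIV. \<Sum>r\<in>UNIV. \<Sum>i\<in>UNIV. weight p k * weight p r * (V i * (a k y i * a r x i)))"
      by (subst sum.swap, intro sum.cong refl, rule sum.swap)
    finally show ?thesis by (simp add: X_def sum_distrib_left)
  qed
  finally show ?thesis by (simp only: mean X_def D_def V_def a_def f_def)
qed

lemma sparse_hessian_symmetric:
  "y \<bullet> (sparse_hessian p \<rho> istar \<beta> *v x) = x \<bullet> (sparse_hessian p \<rho> istar \<beta> *v y)"
  unfolding inner_sparse_hessian by (simp add: mult.commute)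

lemma weighted_variance:
  fixes q x :: "'a::finite \<Rightarrow> real"
  assumes q: "(\<Sum>i\<in>UNIV. q i) = 1"
  defines "m \<equiv> (\<Sum>i\<in>UNIV. q i * x i)"
  shows "(\<Sum>i\<in>UNIV. q i * (x i * x i)) - m * m = (\<Sum>i\<in>UNIV. q i * (x i - m)\<^sup>2)"
proof -
  have "(\<Sum>i\<in>UNIV. q i * (x i - m)\<^sup>2)
      = (\<Sum>i\<in>UNIV. q i * (x i * x i) - 2 * m * (q i * x i) + m * m * q i)"
    by (intro sum.cong refl) (simp add: power2_eq_square algebra_simps)
  also have "\<dots> = (\<Sum>i\<in>UNIV. q i * (x i * x i)) - 2 * m * m + m * m"
    by (simp add: sum.distrib sum_subtractf q flip: sum_distrib_left m_def)
  finally show ?thesis by simp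
qed

lemma sparse_gamma_nth:
  "sparse_gamma p \<rho> istar \<beta> k $ j
    = (\<Sum>i\<in>UNIV. bary p \<beta> $ i * sparse_plan p \<rho> istar k (blk \<beta> k) $ i $ j)"
  by (simp add: sparse_gamma_def matrix_vector_mult_def transpose_def mult.commute)

lemma sum_sparse_gamma:
  "(\<Sum>j\<in>UNIV. sparse_gamma p \<rho> istar \<beta> k $ j * h j)
    = (\<Sum>i\<in>UNIV. bary p \<beta> $ i * (\<Sum>j\<in>UNIV. sparse_plan p \<rho> istar k (blk \<beta> k) $ i $ j * h j))"
  unfolding sparse_gamma_nth sum_distrib_left sum_distrib_right
  by (subst sum.swap) (simp add: mult.assoc)

lemma plan_mean_nth:
  "plan_mean p \<rho> istar \<beta> k x i = (\<Sum>j\<in>UNIV. sparse_plan p \<rho> istar k (blk \<beta> k) $ i $ j * x $ (k, j))"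
  by (simp add: plan_mean_def matrix_vector_mult_def)

lemma sparse_hessian_quadratic_form:
  fixes x :: "real ^ ('k::finite \<times> 'm::finite)"
  assumes p: "barycenter_problem p" and s: "sparsifiable p \<rho> istar \<beta>"
  defines "m \<equiv> (\<Sum>i\<in>UNIV. bary p \<beta> $ i * mixture_mean p \<rho> istar \<beta> x i)"
  shows "x \<bullet> (sparse_hessian p \<rho> istar \<beta> *v x) =
    (\<Sum>i\<in>UNIV. bary p \<beta> $ i * (mixture_mean p \<rho> istar \<beta> x i - m)\<^sup>2) / tau p
    + (\<Sum>k\<in>UNIV. weight p k / eta p * (\<Sum>i\<in>UNIV. bary p \<beta> $ i *
        (\<Sum>j\<in>UNIV. sparse_plan p \<rho> istar k (blk \<beta> k) $ i $ j *
          (x $ (k, j) - plan_mean p \<rho> istar \<beta> k x i)\<^sup>2)))"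
proof -
  have "(\<Sum>j\<in>UNIV. sparse_plan p \<rho> istar k (blk \<beta> k) $ i $ j * (x $ (k, j) * x $ (k, j)))
      - plan_mean p \<rho> istar \<beta> k x i * plan_mean p \<rho> istar \<beta> k x i
      = (\<Sum>j\<in>UNIV. sparse_plan p \<rho> istar k (blk \<beta> k) $ i $ j *
          (x $ (k, j) - plan_mean p \<rho> istar \<beta> k x i)\<^sup>2)" for k i
    unfolding plan_mean_nth by (rule weighted_variance[OF sparse_plan_row_sum[OF p s]])
  then have "(\<Sum>j\<in>UNIV. sparse_gamma p \<rho> istar \<beta> k $ j * (x $ (k, j) * x $ (k, j)))
      - (\<Sum>i\<in>UNIV. bary p \<beta> $ i * (plan_mean p \<rho> istar \<beta> k x i * plan_mean p \<rho> istar \<beta> k x i))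
      = (\<Sum>i\<in>UNIV. bary p \<beta> $ i * (\<Sum>j\<in>UNIV. sparse_plan p \<rho> istar k (blk \<beta> k) $ i $ j *
          (x $ (k, j) - plan_mean p \<rho> istar \<beta> k x i)\<^sup>2))" for k
    unfolding sum_sparse_gamma sum_subtractf[symmetric] right_diff_distrib[symmetric] by simp
  then show ?thesis
    unfolding inner_sparse_hessian m_def
    using weighted_variance[OF bary_sum[OF p], of \<beta> "mixture_mean p \<rho> istar \<beta> x"] by simp
qed

lemma sparse_hessian_psd:
  assumes p: "barycenter_problem p" and s: "sparsifiable p \<rho> istar \<beta>"
  shows "0 \<le> x \<bullet> (sparse_hessian p \<rho> istar \<beta> *v x)"
  unfolding sparse_hessian_quadratic_form[OF p s]
  by (intro add_nonneg_nonneg divide_nonneg_nonneg mult_nonneg_nonneg sum_nonneg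
      less_imp_le[OF bary_pos[OF p]] sparse_plan_nonneg[OF p] zero_le_power2
      less_imp_le[OF problemD(1)[OF p]] less_imp_le[OF problemD(2)[OF p]] less_imp_le[OF problemD(5)[OF p]])

text \<open>
  The row \<open>istar\<close> decides: it has positive mass and, not being sparsified, positive entries, so a
  vanishing conditional variance there forces the whole block to equal its mean.
\<close>

lemma sparse_hessian_null_imp_block_constant:
  assumes p: "barycenter_problem p" and s: "sparsifiable p \<rho> istar \<beta>"
    and null: "sparse_hessian p \<rho> istar \<beta> *v x = 0"
  shows "x $ (k, j) = plan_mean p \<rho> istar \<beta> k x istar"
proof (rule ccontr)
  assume ne: "x $ (k, j) \<noteq> plan_mean p \<rho> istar \<beta> k x istar"
  let ?S = "\<lambda>k. sparse_plan p \<rho> istar k (blk \<beta> k)" and ?A = "\<lambda>k. plan_mean p \<rho> istar \<beta> k x"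
  note nonneg = sum_nonneg mult_nonneg_nonneg less_imp_le[OF bary_pos[OF p]] sparse_plan_nonneg[OF p]
    zero_le_power2 divide_nonneg_nonneg less_imp_le[OF problemD(1)[OF p]] less_imp_le[OF problemD(2)[OF p]]
    less_imp_le[OF problemD(5)[OF p]]
  have row: "0 < (\<Sum>j\<in>UNIV. ?S k $ istar $ j * (x $ (k, j) - ?A k istar)\<^sup>2)"
    by (rule sum_pos2[of _ j]) (use ne sparse_plan_istar_pos[OF p] in \<open>auto intro!: nonneg\<close>)
  have rows: "0 < (\<Sum>i\<in>UNIV. bary p \<beta> $ i * (\<Sum>j\<in>UNIV. ?S k $ i $ j * (x $ (k, j) - ?A k i)\<^sup>2))"
    by (rule sum_pos2[of _ istar]) (use row bary_pos[OF p] in \<open>auto intro!: nonneg\<close>)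
  have "0 < (\<Sum>k\<in>UNIV. weight p k / eta p *
      (\<Sum>i\<in>UNIV. bary p \<beta> $ i * (\<Sum>j\<in>UNIV. ?S k $ i $ j * (x $ (k, j) - ?A k i)\<^sup>2)))"
    by (rule sum_pos2[of _ k]) (use rows problemD(1,5)[OF p] in \<open>auto intro!: nonneg\<close>)
  then have "0 < x \<bullet> (sparse_hessian p \<rho> istar \<beta> *v x)"
    unfolding sparse_hessian_quadratic_form[OF p s]
    by (intro add_nonneg_pos) (auto intro!: nonneg)
  then show False using null by simp
qed

definition block_indicator :: "'k \<Rightarrow> real ^ ('k::finite \<times> 'm::finite)" where
  "block_indicator k = (\<chi> a. if fst a = k then 1 else 0)"

lemma inner_block_indicator: "block_indicator k \<bullet> x = (\<Sum>j\<in>UNIV. x $ (k, j))"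
proof -
  have "block_indicator k \<bullet> x = (\<Sum>r\<in>UNIV. if r = k then (\<Sum>j\<in>UNIV. x $ (r, j)) else 0)"
    unfolding inner_vec_def sum_pairs by (intro sum.cong refl) (simp add: block_indicator_def)
  then show ?thesis by simp
qed

text \<open>
  The means of a block indicator are the same in every row, and a constant has covariance zero with
  everything.
\<close>

lemma block_indicator_sparse_hessian:
  assumes p: "barycenter_problem p" and s: "sparsifiable p \<rho> istar \<beta>"
  shows "block_indicator k \<bullet> (sparse_hessian p \<rho> istar \<beta> *v x) = 0"
proof -
  have mean: "plan_mean p \<rho> istar \<beta> r (block_indicator k) i = (if r = k then 1 else 0)" for r i
    by (simp add: plan_mean_nth block_indicator_def sparse_plan_row_sum[OF p s])
  have mix: "mixture_mean p \<rho> istar \<beta> (block_indicator k) i = weight p k" for i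
    by (simp add: mixture_mean_def mean if_distrib[of "\<lambda>x. _ * x"] cong: if_cong)
  have "(\<Sum>j\<in>UNIV. sparse_gamma p \<rho> istar \<beta> r $ j * (block_indicator k $ (r, j) * x $ (r, j)))
     = (\<Sum>i\<in>UNIV. bary p \<beta> $ i * (plan_mean p \<rho> istar \<beta> r (block_indicator k) i * plan_mean p \<rho> istar \<beta> r x i))" for r
    unfolding sum_sparse_gamma mean by (simp add: block_indicator_def plan_mean_nth)
  moreover have "(\<Sum>i\<in>UNIV. bary p \<beta> $ i * (weight p k * mixture_mean p \<rho> istar \<beta> x i))
      = weight p k * (\<Sum>i\<in>UNIV. bary p \<beta> $ i * mixture_mean p \<rho> istar \<beta> x i)"
    by (simp add: sum_distrib_left mult_ac)
  ultimately show ?thesis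
    by (simp add: inner_sparse_hessian mix bary_sum[OF p] flip: sum_distrib_right)
qed

text \<open>
  The kernel is spanned by the block indicators: they lie in it by symmetry and the previous
  orthogonality, and everything in it is constant on blocks.
\<close>

lemma orthogonal_comp_sparse_hessian_kernel:
  fixes p :: "('n::finite, 'm::finite, 'k::finite) barycenter_data"
  assumes p: "barycenter_problem p" and s: "sparsifiable p \<rho> istar \<beta>"
  shows "orthogonal_comp {x. sparse_hessian p \<rho> istar \<beta> *v x = 0} = block_centred"
proof (intro set_eqI iffI)
  fix y assume y: "y \<in> orthogonal_comp {x. sparse_hessian p \<rho> istar \<beta> *v x = 0}"
  have "sparse_hessian p \<rho> istar \<beta> *v block_indicator k = 0" for k
  proof -
    let ?z = "sparse_hessian p \<rho> istar \<beta> *v block_indicator k"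
    have "?z \<bullet> ?z = block_indicator k \<bullet> (sparse_hessian p \<rho> istar \<beta> *v ?z)"
      by (rule sparse_hessian_symmetric)
    then show ?thesis using block_indicator_sparse_hessian[OF p s] by simp
  qed
  then have "block_indicator k \<bullet> y = 0" for k
    using y by (auto simp: orthogonal_comp_def orthogonal_def)
  then show "y \<in> block_centred" by (simp add: block_centred_def inner_block_indicator)
next
  fix y :: "real ^ ('k \<times> 'm)" assume y: "y \<in> block_centred"
  show "y \<in> orthogonal_comp {x. sparse_hessian p \<rho> istar \<beta> *v x = 0}"
    unfolding orthogonal_comp_def orthogonal_def
  proof (intro CollectI ballI)
    fix x assume "x \<in> {x. sparse_hessian p \<rho> istar \<beta> *v x = 0}"
    then have "x $ (k, j) = plan_mean p \<rho> istar \<beta> k x istar" for k j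
      using sparse_hessian_null_imp_block_constant[OF p s] by simp
    then have "x \<bullet> y = (\<Sum>k\<in>UNIV. plan_mean p \<rho> istar \<beta> k x istar * (\<Sum>j\<in>UNIV. y $ (k, j)))"
      unfolding inner_vec_def sum_pairs sum_distrib_left by simp
    then show "x \<bullet> y = 0" using y by (simp add: block_centred_def)
  qed
qed

text \<open>
  All entries of the plans, of \<open>bary\<close> and of \<open>sparse_gamma\<close> lie between 0 and 1, so the entries of the
  Hessian are bounded in terms of \<open>eta p\<close> and \<open>tau p\<close> only. The decrease per iteration is uniform
  because the constant is the same for all thresholds and points.
\<close>

lemma sparse_hessian_bounded:
  fixes p :: "('n::finite, 'm::finite, 'k::finite) barycenter_data"
  assumes p: "barycenter_problem p"
  obtains M where "0 < M"
    "\<And>\<rho> istar \<beta> x. sparsifiable p \<rho> istar \<beta> \<Longrightarrow> norm (sparse_hessian p \<rho> istar \<beta> *v x) \<le> M * norm x"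
proof -
  note eta = problemD(1)[OF p] and tau = problemD(2)[OF p] and w = problemD(5)[OF p]
  have w1: "weight p k \<le> 1" for k
    unfolding problemD(6)[OF p, symmetric] using w by (intro member_le_sum) (auto simp: less_imp_le)
  define B where "B = 2 / tau p + 2 / eta p"
  define M where "M = real CARD('k \<times> 'm) * real CARD('k \<times> 'm) * B"
  have entry: "\<bar>sparse_hessian p \<rho> istar \<beta> $ a $ b\<bar> \<le> B"
    if s: "sparsifiable p \<rho> istar \<beta>" for \<rho> istar \<beta> a b
  proof -
    obtain k j r l where a: "a = (k, j)" and b: "b = (r, l)" by (cases a, cases b)
    let ?S = "\<lambda>k. sparse_plan p \<rho> istar k (blk \<beta> k)"
    have S1: "?S k $ i $ j \<le> 1" for k i j
      unfolding sparse_plan_row_sum[OF p s, of k i, symmetric]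
      by (intro member_le_sum) (auto simp: sparse_plan_nonneg[OF p])
    have avg: "\<bar>\<Sum>i\<in>UNIV. bary p \<beta> $ i * h i\<bar> \<le> 1" if "\<And>i. 0 \<le> h i" "\<And>i. h i \<le> 1" for h
    proof -
      have "(\<Sum>i\<in>UNIV. bary p \<beta> $ i * h i) \<le> (\<Sum>i\<in>UNIV. bary p \<beta> $ i)"
        using that by (intro sum_mono mult_left_le less_imp_le[OF bary_pos[OF p]]) auto
      moreover have "0 \<le> (\<Sum>i\<in>UNIV. bary p \<beta> $ i * h i)"
        using that by (intro sum_nonneg mult_nonneg_nonneg less_imp_le[OF bary_pos[OF p]])
      ultimately show ?thesis by (simp add: bary_sum[OF p])
    qed
    have \<gamma>: "\<bar>sparse_gamma p \<rho> istar \<beta> k $ j\<bar> \<le> 1" for k j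
      unfolding sparse_gamma_nth by (intro avg sparse_plan_nonneg[OF p] S1)
    have "sparse_cross p \<rho> istar \<beta> k r $ j $ l
        = (\<Sum>i\<in>UNIV. bary p \<beta> $ i * (?S k $ i $ j * ?S r $ i $ l))" for k r j l
      by (simp add: sparse_cross_def matrix_matrix_mult_def transpose_def diag_mat_def
          if_distrib[of "\<lambda>x. _ * x"] cong: if_cong) (simp add: mult_ac)
    then have X: "\<bar>sparse_cross p \<rho> istar \<beta> k r $ j $ l\<bar> \<le> 1" for k r j l
      by (simp only:) (intro avg mult_nonneg_nonneg mult_le_one sparse_plan_nonneg[OF p] S1)
    have diag: "\<bar>diag_mat (sparse_gamma p \<rho> istar \<beta> k) $ j $ l\<bar> \<le> 1"
      using \<gamma> by (simp add: diag_mat_def)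
    have "\<bar>sparse_gamma p \<rho> istar \<beta> k $ j * sparse_gamma p \<rho> istar \<beta> r $ l\<bar> \<le> 1"
      unfolding abs_mult by (intro mult_le_one \<gamma> abs_ge_zero)
    with X[of k r j l] have first: "\<bar>sparse_cross p \<rho> istar \<beta> k r $ j $ l
        - sparse_gamma p \<rho> istar \<beta> k $ j * sparse_gamma p \<rho> istar \<beta> r $ l\<bar> \<le> 2" by linarith
    have second: "\<bar>diag_mat (sparse_gamma p \<rho> istar \<beta> k) $ j $ l - sparse_cross p \<rho> istar \<beta> k k $ j $ l\<bar> \<le> 2"
      using diag X[of k k j l] by linarith
    have "weight p k * weight p r \<le> 1"
      by (intro mult_le_one w1 less_imp_le[OF w])
    then have c1: "\<bar>weight p k * weight p r / tau p\<bar> \<le> 1 / tau p"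
      using w[of k] w[of r] tau by (simp add: abs_mult divide_right_mono)
    have c2: "\<bar>weight p k / eta p\<bar> \<le> 1 / eta p"
      using w[of k] w1[of k] eta by (simp add: divide_right_mono)
    have t1: "\<bar>weight p k * weight p r / tau p * (sparse_cross p \<rho> istar \<beta> k r $ j $ l
        - sparse_gamma p \<rho> istar \<beta> k $ j * sparse_gamma p \<rho> istar \<beta> r $ l)\<bar> \<le> 1 / tau p * 2"
      unfolding abs_mult[of "weight p k * weight p r / tau p"] using tau by (intro mult_mono c1 first) auto
    have t2: "\<bar>weight p k / eta p * (diag_mat (sparse_gamma p \<rho> istar \<beta> k) $ j $ l
        - sparse_cross p \<rho> istar \<beta> k k $ j $ l)\<bar> \<le> 1 / eta p * 2"
      unfolding abs_mult[of "weight p k / eta p"] using eta by (intro mult_mono c2 second) auto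
    have eq: "sparse_hessian p \<rho> istar \<beta> $ a $ b
        = weight p k * weight p r / tau p * (sparse_cross p \<rho> istar \<beta> k r $ j $ l
            - sparse_gamma p \<rho> istar \<beta> k $ j * sparse_gamma p \<rho> istar \<beta> r $ l)
          + (if k = r then weight p k / eta p * (diag_mat (sparse_gamma p \<rho> istar \<beta> k) $ j $ l
            - sparse_cross p \<rho> istar \<beta> k k $ j $ l) else 0)"
      by (simp add: sparse_hessian_def sparse_hessian_block_def a b)
    have "\<bar>u + (if k = r then u' else 0)\<bar> \<le> B"
      if "\<bar>u\<bar> \<le> 1 / tau p * 2" "\<bar>u'\<bar> \<le> 1 / eta p * 2" for u u'
      using that divide_pos_pos[OF zero_less_one eta] unfolding B_def by (cases "k = r") auto
    then show ?thesis unfolding eq using t1 t2 by blast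
  qed
  show thesis
  proof (rule that[of M])
    show "0 < M" using eta tau by (simp add: M_def B_def add_pos_pos)
    fix \<rho> istar \<beta> x assume s: "sparsifiable p \<rho> istar \<beta>"
    have "onorm ((*v) (sparse_hessian p \<rho> istar \<beta>)) \<le> M"
      unfolding M_def by (rule onorm_le_matrix_component[OF entry[OF s]])
    then show "norm (sparse_hessian p \<rho> istar \<beta> *v x) \<le> M * norm x"
      using onorm[OF matrix_vector_mul_bounded_linear[of "sparse_hessian p \<rho> istar \<beta>"], of x]
        mult_right_mono[of _ M "norm x"] by (meson norm_ge_zero order_trans)
  qed
qed

section \<open>The regularised Newton direction\<close>

text \<open>
  Shifting a positive semidefinite matrix by \<open>norm g\<close> makes it invertible. Pairing the linear system
  with \<open>d\<close> gives \<open>norm g * (norm d)\<^sup>2 \<le> - (g \<bullet> d)\<close>. By Cauchy-Schwarz this bounds \<open>d\<close> by 1, which is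
  why the shift has to be proportional to the gradient; together with a lower bound on \<open>d\<close> from the
  bound on \<open>H\<close> it gives a decrease that depends only on \<open>norm g\<close> and \<open>M\<close>.
\<close>

lemma regularized_newton_direction:
  fixes H :: "real ^ 'a ^ 'a" and g :: "real ^ 'a"
  assumes psd: "\<And>x. 0 \<le> x \<bullet> (H *v x)"
    and bound: "\<And>x. norm (H *v x) \<le> M * norm x" and "0 < M" and "g \<noteq> 0"
  defines "d \<equiv> - (matrix_inv (H + norm g *\<^sub>R mat 1) *v g)"
  shows "H *v d + norm g *\<^sub>R d = - g" and "norm d \<le> 1"
    and "g \<bullet> d \<le> - (norm g * (norm g / (M + norm g))\<^sup>2)"
proof -
  let ?A = "H + norm g *\<^sub>R mat 1"
  have g: "0 < norm g" using \<open>g \<noteq> 0\<close> by simp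
  have A: "?A *v x = H *v x + norm g *\<^sub>R x" for x
    by (simp add: matrix_vector_mult_add_rdistrib flip: scaleR_matrix_vector_assoc)
  have "x = 0" if "?A *v x = 0" for x
  proof -
    have "x \<bullet> (H *v x) + norm g * (x \<bullet> x) = 0"
      using arg_cong[OF that, of "(\<bullet>) x"] by (simp add: A inner_add_right)
    moreover have "0 \<le> norm g * (x \<bullet> x)" by simp
    ultimately have "norm g * (x \<bullet> x) = 0" using psd[of x] by linarith
    then show ?thesis using g by simp
  qed
  then have "invertible ?A"
    unfolding invertible_left_inverse matrix_left_invertible_ker by blast
  then have "?A ** matrix_inv ?A = mat 1"
    unfolding invertible_def matrix_inv_def by (rule someI2_ex) simp
  then have "?A *v (matrix_inv ?A *v g) = g" by (simp add: matrix_vector_mul_assoc)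
  moreover have "?A *v d = - (?A *v (matrix_inv ?A *v g))"
    unfolding d_def by (rule linear_neg[OF matrix_vector_mul_linear])
  ultimately have "?A *v d = - g" by simp
  then show eq: "H *v d + norm g *\<^sub>R d = - g" by (simp add: A)
  have desc: "d \<bullet> (H *v d) + norm g * (norm d)\<^sup>2 = - (g \<bullet> d)"
    using arg_cong[OF eq, of "(\<bullet>) d"] by (simp add: inner_add_right inner_commute power2_norm_eq_inner)
  have "norm g * (norm d)\<^sup>2 \<le> norm g * norm d"
    using desc psd[of d] norm_cauchy_schwarz[of "- g" d] by simp
  then have "norm d * norm d \<le> 1 * norm d" using g by (simp add: power2_eq_square)
  then show "norm d \<le> 1" by (metis mult_le_cancel_right norm_ge_zero not_le zero_le_one order.trans)
  have "norm g \<le> norm (H *v d) + norm (norm g *\<^sub>R d)"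
    using norm_triangle_ineq[of "H *v d" "norm g *\<^sub>R d"] by (simp add: eq)
  also have "\<dots> \<le> (M + norm g) * norm d"
    using bound[of d] by (simp add: algebra_simps)
  finally have "norm g / (M + norm g) \<le> norm d"
    using g \<open>0 < M\<close> by (subst pos_divide_le_eq) (auto simp: mult.commute add_pos_nonneg)
  then have "(norm g / (M + norm g))\<^sup>2 \<le> (norm d)\<^sup>2"
    using g \<open>0 < M\<close> by (intro power_mono) auto
  then have "norm g * (norm g / (M + norm g))\<^sup>2 \<le> norm g * (norm d)\<^sup>2"
    by (intro mult_left_mono) auto
  then show "g \<bullet> d \<le> - (norm g * (norm g / (M + norm g))\<^sup>2)"
    using desc psd[of d] by linarith
qed

lemma subspace_block_centred: "subspace block_centred"
  by (auto simp: subspace_def block_centred_def sum.distrib simp flip: sum_distrib_left)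

lemma closed_block_centred: "closed block_centred"
  by (rule closed_subspace[OF subspace_block_centred])

text \<open>
  The range of the Hessian and the gradient are both orthogonal to every block indicator, so pairing
  the Newton equation with an indicator leaves only the multiple of the direction. Hence the
  iterates never leave the subspace on which the loss is coercive and strictly convex.
\<close>

lemma direction_block_centred:
  assumes p: "barycenter_problem p" and s: "sparsifiable p (C\<rho> * norm (grad_loss p \<beta>)) istar \<beta>"
  shows "direction p C\<rho> istar \<beta> \<in> block_centred"
proof (cases "grad_loss p \<beta> = 0")
  case True
  then show ?thesis by (simp add: direction_def block_centred_def)
next
  case False
  obtain M where M: "0 < M"
    "\<And>\<rho> istar \<beta> x. sparsifiable p \<rho> istar \<beta> \<Longrightarrow> norm (sparse_hessian p \<rho> istar \<beta> *v x) \<le> M * norm x"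
    using sparse_hessian_bounded[OF p] by blast
  let ?g = "grad_loss p \<beta>" and ?d = "direction p C\<rho> istar \<beta>"
  let ?H = "sparse_hessian p (C\<rho> * norm ?g) istar \<beta>"
  have eq: "?H *v ?d + norm ?g *\<^sub>R ?d = - ?g"
    using regularized_newton_direction(1)[OF sparse_hessian_psd[OF p s] M(2)[OF s] M(1) False] False
    by (simp add: direction_def Let_def)
  have "block_indicator k \<bullet> ?g = 0" for k
    by (simp add: inner_block_indicator grad_loss_eq[OF p] semidual_grad_block_sum[OF p])
  then have "norm ?g * (block_indicator k \<bullet> ?d) = 0" for k
    using arg_cong[OF eq, of "(\<bullet>) (block_indicator k)"] block_indicator_sparse_hessian[OF p s, of k ?d]
    by (simp add: inner_add_right)
  then show ?thesis using False by (simp add: block_centred_def inner_block_indicator)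
qed

text \<open>
  A nonzero block-centred displacement cannot be constant on every block, so the tangent inequality
  is strict in its direction.
\<close>

lemma critical_point_strict_minimum:
  fixes p :: "('n::finite, 'm::finite, 'k::finite) barycenter_data"
  assumes p: "barycenter_problem p" and z: "z \<in> block_centred" "semidual_grad p z = 0"
    and y: "y \<in> block_centred" "y \<noteq> z"
  shows "loss p z < loss p y"
proof -
  have diff: "y - z \<in> block_centred" using subspace_diff[OF subspace_block_centred y(1) z(1)] .
  have "\<exists>k j1 j2. (y - z) $ (k, j1) \<noteq> (y - z) $ (k, j2)"
  proof (rule ccontr)
    assume const: "\<nexists>k j1 j2. (y - z) $ (k, j1) \<noteq> (y - z) $ (k, j2)"
    have "(y - z) $ (k, j) = 0" for k j
    proof -
      have "0 = (\<Sum>j'\<in>UNIV. (y - z) $ (k, j'))" using diff by (simp only: block_centred_def mem_Collect_eq)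
      also have "\<dots> = (\<Sum>j'\<in>(UNIV::'m set). (y - z) $ (k, j))" using const by (intro sum.cong) auto
      finally show ?thesis by simp
    qed
    then show False using y(2) by (auto simp: vec_eq_iff)
  qed
  then obtain k j1 j2 where "(y - z) $ (k, j1) \<noteq> (y - z) $ (k, j2)" by blast
  from loss_above_tangent(2)[OF p this] show ?thesis using z(2) by simp
qed

section \<open>Global convergence\<close>

theorem theorem5p2:
  fixes p :: "('n::finite, 'm::finite, 'k::finite) barycenter_data"
    and C\<rho> \<sigma> c :: real
    and istar :: "nat \<Rightarrow> 'n"
    and \<beta> :: "nat \<Rightarrow> real ^ ('k \<times> 'm)"
    and \<rho>' :: real and istar' :: 'n and \<beta>' :: "real ^ ('k \<times> 'm)"
    and V :: "(real ^ ('k \<times> 'm)) set"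
  assumes "barycenter_problem p"
    and "0 \<le> C\<rho>" and "0 < \<sigma>" and "\<sigma> < 1" and "0 < c" and "c < 1"
    and "0 \<le> \<rho>'" and "sparsifiable p \<rho>' istar' \<beta>'"
    and "V = orthogonal_comp {x. sparse_hessian p \<rho>' istar' \<beta>' *v x = 0}"
    and "\<beta> 0 \<in> V"
    and "newton_sequence p C\<rho> \<sigma> c istar \<beta>"
  shows "(\<lambda>t. norm (grad_loss p (\<beta> t))) \<longlonglongrightarrow> 0 \<and>
    (\<exists>\<beta>star. is_arg_min (loss p) (\<lambda>x. x \<in> V) \<beta>star \<and>
       (\<forall>y. is_arg_min (loss p) (\<lambda>x. x \<in> V) y \<longrightarrow> y = \<beta>star) \<and>
       \<beta> \<longlonglongrightarrow> \<beta>star)"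
proof -
  note p = \<open>barycenter_problem p\<close> and par = assms(3-6)
  let ?G = "semidual_grad p"
  have V: "V = block_centred"
    using assms(8,9) orthogonal_comp_sparse_hessian_kernel[OF p] by simp
  note sub = loss_above_tangent(1)[OF p] and cont = continuous_semidual_grad[OF p]
  define d where "d t = direction p C\<rho> (istar t) (\<beta> t)" for t
  define l where "l t = (LEAST j. armijo p \<sigma> (\<beta> t) (d t) (c ^ j))" for t
  have s: "sparsifiable p (C\<rho> * norm (grad_loss p (\<beta> t))) (istar t) (\<beta> t)" for t
    using assms(11) by (simp add: newton_sequence_def)
  have step: "\<beta> (Suc t) = \<beta> t + c ^ l t *\<^sub>R d t" for t
    using assms(11) by (simp add: newton_sequence_def Let_def step_size_def d_def l_def)
  obtain M where M: "0 < M"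
    "\<And>\<rho> istar \<beta> x. sparsifiable p \<rho> istar \<beta> \<Longrightarrow> norm (sparse_hessian p \<rho> istar \<beta> *v x) \<le> M * norm x"
    using sparse_hessian_bounded[OF p] by blast
  have d_zero: "d t = 0" if "?G (\<beta> t) = 0" for t
    using that by (simp add: d_def direction_def grad_loss_eq[OF p])
  have d_nonzero: "norm (d t) \<le> 1"
    "?G (\<beta> t) \<bullet> d t \<le> - (norm (?G (\<beta> t)) * (norm (?G (\<beta> t)) / (M + norm (?G (\<beta> t))))\<^sup>2)"
    if "?G (\<beta> t) \<noteq> 0" for t
    using regularized_newton_direction(2,3)[OF sparse_hessian_psd[OF p s] M(2)[OF s] M(1), of "?G (\<beta> t)" t] that
    by (simp_all add: d_def direction_def Let_def grad_loss_eq[OF p])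
  have d_norm: "norm (d t) \<le> 1" for t
    using d_zero d_nonzero by (cases "?G (\<beta> t) = 0") auto
  \<comment> \<open>If the gradient vanishes, the direction is zero and the step length 1 is accepted trivially.\<close>
  have d_desc: "?G (\<beta> t) \<bullet> d t < 0 \<or> d t = 0" for t
  proof (cases "?G (\<beta> t) = 0")
    case False
    then have "0 < norm (?G (\<beta> t)) * (norm (?G (\<beta> t)) / (M + norm (?G (\<beta> t))))\<^sup>2"
      using M(1) by (intro mult_pos_pos zero_less_power divide_pos_pos) (auto simp: add_pos_pos)
    then show ?thesis using d_nonzero(2)[OF False] by linarith
  qed (simp add: d_zero)
  have d_le: "?G (\<beta> t) \<bullet> d t \<le> 0" for t
    using d_desc[of t] by auto
  have armijo_iff: "armijo p \<sigma> x e h \<longleftrightarrow> loss p (x + h *\<^sub>R e) \<le> loss p x + \<sigma> * h * (?G x \<bullet> e)" for x e h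
    by (simp add: armijo_def grad_loss_eq[OF p])
  have "\<exists>j. armijo p \<sigma> (\<beta> t) (d t) (c ^ j)" for t
    unfolding armijo_iff by (intro armijo_step_exists[OF sub cont] par d_norm d_desc)
  then have ok: "loss p (\<beta> t + c ^ l t *\<^sub>R d t) \<le> loss p (\<beta> t) + \<sigma> * c ^ l t * (?G (\<beta> t) \<bullet> d t)" for t
    unfolding l_def armijo_iff[symmetric] by (rule LeastI_ex)
  have least: "\<not> loss p (\<beta> t + c ^ j *\<^sub>R d t) \<le> loss p (\<beta> t) + \<sigma> * c ^ j * (?G (\<beta> t) \<bullet> d t)"
    if "j < l t" for t j
    using not_less_Least[OF that[unfolded l_def]] by (simp add: armijo_iff)
  have in_V: "\<beta> t \<in> block_centred" for t
  proof (induction t)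
    case 0
    then show ?case using assms(10) V by simp
  next
    case (Suc t)
    then show ?case
      unfolding step d_def
      by (intro subspace_add subspace_scale subspace_block_centred direction_block_centred[OF p s])
  qed
  have sublevel: "loss p (\<beta> t) \<le> loss p (\<beta> 0)" for t
  proof (induction t)
    case (Suc t)
    have "\<sigma> * c ^ l t * (?G (\<beta> t) \<bullet> d t) \<le> 0"
      using par d_le[of t] by (intro mult_nonneg_nonpos) auto
    then show ?case using Suc ok[of t] by (simp add: step)
  qed simp
  have bdd: "bounded (range \<beta>)"
    using in_V sublevel by (intro bounded_subset[OF bounded_loss_sublevel[OF p, of "loss p (\<beta> 0)"]]) auto
  have related: "\<exists>\<kappa>>0. \<forall>t. \<epsilon> \<le> norm (?G (\<beta> t)) \<longrightarrow> ?G (\<beta> t) \<bullet> d t \<le> - \<kappa>" if "0 < \<epsilon>" for \<epsilon>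
  proof (intro exI conjI allI impI)
    show "0 < \<epsilon> * (\<epsilon> / (M + \<epsilon>))\<^sup>2"
      using that M(1) by (intro mult_pos_pos zero_less_power divide_pos_pos) auto
    fix t assume t: "\<epsilon> \<le> norm (?G (\<beta> t))"
    have "\<epsilon> / (M + \<epsilon>) \<le> norm (?G (\<beta> t)) / (M + norm (?G (\<beta> t)))"
      using t that M(1) by (simp add: divide_simps add_pos_pos) (simp add: algebra_simps)
    then have "\<epsilon> * (\<epsilon> / (M + \<epsilon>))\<^sup>2 \<le> norm (?G (\<beta> t)) * (norm (?G (\<beta> t)) / (M + norm (?G (\<beta> t))))\<^sup>2"
      using t that M(1) by (intro mult_mono power_mono) auto
    then show "?G (\<beta> t) \<bullet> d t \<le> - (\<epsilon> * (\<epsilon> / (M + \<epsilon>))\<^sup>2)"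
      using d_nonzero(2)[of t] t that by force
  qed
  have G0: "(\<lambda>t. norm (?G (\<beta> t))) \<longlonglongrightarrow> 0"
    by (rule armijo_descent_gradient_tendsto_zero[OF sub cont par bdd d_norm d_le related step ok least])
  \<comment> \<open>The gradient limit does not say that the iterates converge; it says that every cluster point is
    critical, and there is only one critical point in the subspace.\<close>
  have cluster: "z \<in> block_centred \<and> ?G z = 0" if "strict_mono r" "(\<beta> \<circ> r) \<longlonglongrightarrow> z" for r z
  proof
    show "z \<in> block_centred"
      by (rule closed_sequentially[OF closed_block_centred _ that(2)]) (simp add: in_V)
    have "(\<lambda>t. ?G (\<beta> (r t))) \<longlonglongrightarrow> ?G z"
      using that(2) by (intro continuous_on_tendsto_compose[OF cont]) (auto simp: comp_def)
    moreover have "(\<lambda>t. ?G (\<beta> (r t))) \<longlonglongrightarrow> 0"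
      using LIMSEQ_subseq_LIMSEQ[OF G0 that(1)] by (simp add: comp_def tendsto_norm_zero_iff)
    ultimately show "?G z = 0" by (rule LIMSEQ_unique)
  qed
  obtain r0 z where "strict_mono r0" "(\<beta> \<circ> r0) \<longlonglongrightarrow> z"
    using bounded_imp_convergent_subsequence[OF bdd] by blast
  then have z: "z \<in> block_centred" "?G z = 0" using cluster by auto
  note min = critical_point_strict_minimum[OF p z]
  have "\<beta> \<longlonglongrightarrow> z"
  proof (rule bounded_sequence_unique_cluster_point[OF bdd])
    fix r y assume "strict_mono r" "(\<beta> \<circ> r) \<longlonglongrightarrow> y"
    then have "y \<in> block_centred" "?G y = 0" using cluster by auto
    then show "y = z" using min[of y] critical_point_strict_minimum[OF p _ _ z(1), of y] by force
  qed
  moreover have "is_arg_min (loss p) (\<lambda>x. x \<in> V) z"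
    unfolding is_arg_min_def V using z(1) min by (metis less_asym less_irrefl)
  moreover have "y = z" if "is_arg_min (loss p) (\<lambda>x. x \<in> V) y" for y
    using that z(1) min unfolding is_arg_min_def V by blast
  ultimately show ?thesis using G0 unfolding grad_loss_eq[OF p] by blast
qed

end
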